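(* For every $k\ge2$ and $j\ge0$: $\nu(Z_{2^k,j}(d_{2^k,j}))=0$; $$\nu(Z_{2^k,j}(d_{2^k,j}+1))\ \begin{cases}=1,& j\equiv 2\pmod 4,\\ \ge 2,& j\not\equiv 2\pmod 4;\end{cases}$$ and for every $M\ge2$, $\nu(Z_{2^k,j}(d_{2^k,j}+M))\ge M+1$.
   Context: Let $E(q)=\prod_{m\ge1}(1-q^m)$. Define $$\gamma(q)=\frac{E(q)^5E(q^2)^5E(q^6)^5}{E(q^3)^{15}},\quad \xi=\xi(q)=\frac{E(q^2)^5E(q^6)}{E(q)E(q^3)^5},\quad \kappa(q)=\frac{\gamma(q^2)^2}{\gamma(q)},$$ and let $U\left(\sum_n a_nq^n\right)=\sum_n a_{2n}q^n$. For $i,j\ge0$, $\zeta_{i,j}=U(\kappa^i\xi^j)$, which equals a polynomial in $\xi$ with integer coefficients; write $\zeta_{i,j}=\sum_m Z_{i,j}(m)\xi^m$. Define $d_{i,j}=5I+J$ if $(i,j)=(2I,2J)$; $5I+J+1$ if $(i,j)=(2I,2J+1)$; $5I+J+3$ if $(i,j)=(2I+1,2J)$ or $(2I+1,2J+1)$. $\nu(n)$ is the $2$-adic valuation of an integer $n$, with $\nu(0)=\infty$. *)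

theory Defs
  imports "HOL-Computational_Algebra.Computational_Algebra" "HOL-Library.Extended_Nat"
begin

text \<open>Formal power series in q with rational coefficients (all series below have
integer coefficients; rationals are used only so that inverses are available).\<close>

definition Eta :: "nat \<Rightarrow> rat fps" where
  "Eta k = lim (\<lambda>N. \<Prod>m\<in>{1..N}. (1 - fps_X ^ (k * m)))"

definition gam :: "nat \<Rightarrow> rat fps" where
  "gam k = Eta k ^ 5 * Eta (2*k) ^ 5 * Eta (6*k) ^ 5 * inverse (Eta (3*k) ^ 15)"

definition xi :: "rat fps" where
  "xi = Eta 2 ^ 5 * Eta 6 * inverse (Eta 1 * Eta 3 ^ 5)"

definition kappa :: "rat fps" where
  "kappa = gam 2 ^ 2 * inverse (gam 1)"

definition Uop :: "rat fps \<Rightarrow> rat fps" where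
  "Uop f = Abs_fps (\<lambda>n. f $ (2 * n))"

definition zeta :: "nat \<Rightarrow> nat \<Rightarrow> rat fps" where
  "zeta i j = Uop (kappa ^ i * xi ^ j)"

definition poly_at_xi :: "int poly \<Rightarrow> rat fps" where
  "poly_at_xi p = poly (map_poly (\<lambda>c. of_int c :: rat fps) p) xi"

definition Zpoly :: "nat \<Rightarrow> nat \<Rightarrow> int poly" where
  "Zpoly i j = (THE p. zeta i j = poly_at_xi p)"

definition Z :: "nat \<Rightarrow> nat \<Rightarrow> nat \<Rightarrow> int" where
  "Z i j m = coeff (Zpoly i j) m"

definition d :: "nat \<Rightarrow> nat \<Rightarrow> nat" where
  "d i j = (if even i then
              (if even j then 5 * (i div 2) + j div 2 else 5 * (i div 2) + j div 2 + 1)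
            else 5 * (i div 2) + j div 2 + 3)"

definition nu :: "int \<Rightarrow> enat" where
  "nu n = (if n = 0 then \<infinity> else enat (multiplicity (2::int) n))"

end

theory Submission
  imports Defs
begin

text \<open>
  Dissecting Ramanujan's theta functions \<open>f(q,-q\<^sup>2)\<close> and \<open>f(-q,q\<^sup>2)\<close> by the parity of the
  summation index and applying the Jacobi triple product gives one linear relation between
  eta quotients of level 12. All further relations come from rigidity: a power series
  satisfying a suitable functional equation under \<open>q \<mapsto> q\<^sup>2\<close> is determined by its constant
  term. The outcome is an odd power series \<open>x\<close> with
  \<open>\<xi>(q\<^sup>2) (1 - x\<^sup>2) = 1\<close>, \<open>\<xi> = (1 + 3x) / (1 + x)\<^sup>2\<close> and \<open>\<kappa> = \<xi>(q\<^sup>2)\<^sup>5 (1 + x)\<^sup>5\<close>.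

  Put \<open>u = \<xi>(q\<^sup>2) (1 + x)\<close> and \<open>v = \<xi>(q\<^sup>2) (1 - x)\<close>, which are exchanged by \<open>q \<mapsto> -q\<close>. Then
  \<open>u + v = 2 \<xi>(q\<^sup>2)\<close>, \<open>u v = \<xi>(q\<^sup>2)\<close>, \<open>\<kappa> = u\<^sup>5\<close> and \<open>\<xi> = 3 v - 2 v\<^sup>2\<close>, so that
  \<open>2 \<zeta>\<^bsub>i,j\<^esub>(q\<^sup>2) = u\<^bsup>5i\<^esup> (3 v - 2 v\<^sup>2)\<^bsup>j\<^esup> + v\<^bsup>5i\<^esup> (3 u - 2 u\<^sup>2)\<^bsup>j\<^esup>\<close>. For \<open>j = 0\<close> this is a Chebyshev
  polynomial up to a power of \<open>\<xi>(q\<^sup>2)\<close>, and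
  \<open>\<zeta>\<^bsub>i,j+2\<^esub> = (10 \<xi> - 8 \<xi>\<^sup>2) \<zeta>\<^bsub>i,j+1\<^esub> - (9 \<xi> - 8 \<xi>\<^sup>2) \<zeta>\<^bsub>i,j\<^esub>\<close>; the 2-adic pattern of the
  coefficients propagates along this recurrence.
\<close>

section \<open>The Jacobi triple product for formal power series\<close>

definition fps_agree :: "nat \<Rightarrow> 'a fps \<Rightarrow> 'a fps \<Rightarrow> bool" where
  "fps_agree K f g \<longleftrightarrow> (\<forall>i<K. f $ i = g $ i)"

lemma fps_agree_refl [simp]: "fps_agree K f f"
  by (simp add: fps_agree_def)

lemma fps_agree_sym: "fps_agree K f g \<Longrightarrow> fps_agree K g f"
  by (simp add: fps_agree_def)

lemma fps_agree_trans [trans]: "fps_agree K f g \<Longrightarrow> fps_agree K g h \<Longrightarrow> fps_agree K f h"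
  by (simp add: fps_agree_def)

text \<open>Replaces limit arguments: infinite products and sums are compared after truncating them
  far enough for each \<open>K\<close>.\<close>

lemma fps_eqI_agree: "(\<And>K. fps_agree K f g) \<Longrightarrow> f = g"
  by (auto simp: fps_agree_def fps_eq_iff)

lemma fps_agree_add:
  "fps_agree K f f' \<Longrightarrow> fps_agree K g g' \<Longrightarrow> fps_agree K (f + g) (f' + g')"
  by (simp add: fps_agree_def)

lemma fps_agree_diff:
  fixes f g :: "'a::group_add fps"
  shows "fps_agree K f f' \<Longrightarrow> fps_agree K g g' \<Longrightarrow> fps_agree K (f - g) (f' - g')"
  by (simp add: fps_agree_def)

lemma fps_agree_mult:
  fixes f g :: "'a::comm_ring_1 fps"
  shows "fps_agree K f f' \<Longrightarrow> fps_agree K g g' \<Longrightarrow> fps_agree K (f * g) (f' * g')"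
  by (auto simp: fps_agree_def fps_mult_nth intro!: sum.cong)

lemma fps_agree_sum:
  assumes "\<And>i. i \<in> I \<Longrightarrow> fps_agree K (f i) (g i)"
  shows "fps_agree K (\<Sum>i\<in>I. f i) (\<Sum>i\<in>I. g i)"
  using assms by (auto simp: fps_agree_def fps_sum_nth intro!: sum.cong)

lemma fps_agree_prod:
  fixes f g :: "'i \<Rightarrow> 'a::comm_ring_1 fps"
  assumes "\<And>i. i \<in> I \<Longrightarrow> fps_agree K (f i) (g i)"
  shows "fps_agree K (\<Prod>i\<in>I. f i) (\<Prod>i\<in>I. g i)"
  using assms
  by (induction I rule: infinite_finite_induct) (auto intro: fps_agree_mult)

lemma fps_agree_power_0:
  fixes a :: "'a::idom fps"
  assumes "a $ 0 = 0" "n \<ge> K"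
  shows "fps_agree K (a ^ n) 0"
  using startsby_zero_power_prefix[OF assms(1), of n] assms(2) by (auto simp: fps_agree_def)

lemma fps_agree_mult_0:
  fixes f g :: "'a::comm_ring_1 fps"
  shows "fps_agree K f 0 \<Longrightarrow> fps_agree K (f * g) 0" "fps_agree K g 0 \<Longrightarrow> fps_agree K (f * g) 0"
  using fps_agree_mult[of K f 0 g g] fps_agree_mult[of K f f g 0] by auto

section \<open>Finite and infinite q-Pochhammer products\<close>

definition qpoch_fin :: "nat \<Rightarrow> 'a::idom fps \<Rightarrow> 'a fps \<Rightarrow> 'a fps" where
  "qpoch_fin N u p = (\<Prod>m<N. 1 - u * p ^ m)"

text \<open>If \<open>p $ 0 = 0\<close>, factors with index above \<open>n\<close> do not affect
  coefficient \<open>n\<close>, so it is final after \<open>Suc n\<close> factors.\<close>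

definition qpoch :: "'a::idom fps \<Rightarrow> 'a fps \<Rightarrow> 'a fps" where
  "qpoch u p = Abs_fps (\<lambda>n. qpoch_fin (Suc n) u p $ n)"

lemma qpoch_fin_0 [simp]: "qpoch_fin 0 u p = 1"
  by (simp add: qpoch_fin_def)

lemma qpoch_fin_Suc: "qpoch_fin (Suc N) u p = qpoch_fin N u p * (1 - u * p ^ N)"
  by (simp add: qpoch_fin_def)

lemma qpoch_fin_agree:
  assumes "p $ 0 = 0" "K \<le> M" "M \<le> N"
  shows "fps_agree K (qpoch_fin M u p) (qpoch_fin N u p)"
  using assms(3)
proof (induction N rule: dec_induct)
  case (step n)
  have "fps_agree K (u * p ^ n) 0"
    using step assms by (intro fps_agree_mult_0 fps_agree_power_0) auto
  hence "fps_agree K (1 - u * p ^ n) (1 - 0)"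
    by (intro fps_agree_diff) auto
  hence "fps_agree K (qpoch_fin M u p * 1) (qpoch_fin n u p * (1 - u * p ^ n))"
    using step by (intro fps_agree_mult) (auto intro: fps_agree_sym)
  thus ?case by (simp add: qpoch_fin_Suc)
qed auto

lemma qpoch_agree:
  assumes "p $ 0 = 0" "K \<le> N"
  shows "fps_agree K (qpoch u p) (qpoch_fin N u p)"
proof -
  have "qpoch_fin (Suc i) u p $ i = qpoch_fin N u p $ i" if "i < K" for i
    using qpoch_fin_agree[OF assms(1), of "Suc i" "Suc i" N u] that assms(2)
    by (auto simp: fps_agree_def)
  thus ?thesis by (auto simp: fps_agree_def qpoch_def)
qed

lemma qpoch_nth_0:
  assumes "u $ 0 = 0"
  shows "qpoch u p $ 0 = 1"
  using assms by (simp add: qpoch_def qpoch_fin_def)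

lemma qpoch_compose:
  assumes "p $ 0 = 0" "w $ 0 = 0"
  shows "qpoch u p oo w = qpoch (u oo w) (p oo w)"
proof (rule fps_eqI_agree)
  fix K
  have "fps_agree K (qpoch u p oo w) (qpoch_fin K u p oo w)"
    using qpoch_agree[OF assms(1), of K K u]
    by (auto simp: fps_agree_def fps_compose_nth)
  also have "qpoch_fin K u p oo w = qpoch_fin K (u oo w) (p oo w)"
    by (simp add: qpoch_fin_def fps_compose_prod_distrib fps_compose_sub_distrib
        fps_compose_mult_distrib fps_compose_power[symmetric] assms)
  also have "fps_agree K \<dots> (qpoch (u oo w) (p oo w))"
    by (rule fps_agree_sym, rule qpoch_agree) (use assms in auto)
  finally show "fps_agree K (qpoch u p oo w) (qpoch (u oo w) (p oo w))" .
qed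

text \<open>The factors are sorted by their index modulo \<open>l\<close>.\<close>

lemma qpoch_split:
  assumes "p $ 0 = 0" "l > 0"
  shows "qpoch u p = (\<Prod>j<l. qpoch (u * p ^ j) (p ^ l))"
proof (rule fps_eqI_agree)
  fix K
  \<comment> \<open>A truncation length divisible by \<open>l\<close> breaks into complete
    blocks.\<close>
  have "K \<le> K * l" using assms by (cases l) auto
  hence "fps_agree K (qpoch u p) (qpoch_fin (K * l) u p)"
    by (intro qpoch_agree assms) 
  also have "qpoch_fin (K * l) u p = (\<Prod>m<K. \<Prod>i\<in>{m * l..<m * l + l}. 1 - u * p ^ i)"
    by (simp add: qpoch_fin_def prod.nat_group)
  also have "\<dots> = (\<Prod>m<K. \<Prod>j<l. 1 - (u * p ^ j) * (p ^ l) ^ m)"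
  proof (rule prod.cong)
    fix m
    show "(\<Prod>i\<in>{m * l..<m * l + l}. 1 - u * p ^ i) = (\<Prod>j<l. 1 - (u * p ^ j) * (p ^ l) ^ m)"
      by (rule prod.reindex_bij_witness[of _ "\<lambda>j. m * l + j" "\<lambda>i. i - m * l"])
         (auto simp: power_mult[symmetric] mult.assoc power_add[symmetric] mult.commute[of l])
  qed auto
  also have "\<dots> = (\<Prod>j<l. qpoch_fin K (u * p ^ j) (p ^ l))"
    unfolding qpoch_fin_def by (rule prod.swap)
  also have "fps_agree K \<dots> (\<Prod>j<l. qpoch (u * p ^ j) (p ^ l))"
    using assms by (intro fps_agree_prod fps_agree_sym[OF qpoch_agree]) auto
  finally show "fps_agree K (qpoch u p) (\<Prod>j<l. qpoch (u * p ^ j) (p ^ l))" .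
qed

lemma qpoch_mult_uminus:
  assumes "p $ 0 = 0"
  shows "qpoch u p * qpoch (- u) p = qpoch (u ^ 2) (p ^ 2)"
proof (rule fps_eqI_agree)
  fix K
  have "fps_agree K (qpoch u p * qpoch (- u) p) (qpoch_fin K u p * qpoch_fin K (- u) p)"
    by (intro fps_agree_mult qpoch_agree assms order.refl)
  also have "qpoch_fin K u p * qpoch_fin K (- u) p = qpoch_fin K (u ^ 2) (p ^ 2)"
    unfolding qpoch_fin_def prod.distrib[symmetric]
    by (intro prod.cong) (auto simp: algebra_simps power2_eq_square power_mult_distrib)
  also have "fps_agree K \<dots> (qpoch (u ^ 2) (p ^ 2))"
    by (rule fps_agree_sym, rule qpoch_agree) (use assms in auto)
  finally show "fps_agree K (qpoch u p * qpoch (- u) p) (qpoch (u ^ 2) (p ^ 2))" .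
qed

text \<open>The term \<open>a\<^bsup>n(n+1)/2\<^esup> b\<^bsup>n(n-1)/2\<^esup>\<close> of Ramanujan's theta function \<open>f(a,b)\<close>.\<close>

definition theta_term :: "'a::idom fps \<Rightarrow> 'a fps \<Rightarrow> int \<Rightarrow> 'a fps" where
  "theta_term a b n = a ^ nat (n * (n + 1) div 2) * b ^ nat (n * (n - 1) div 2)"

definition theta_prod :: "'a::idom fps \<Rightarrow> 'a fps \<Rightarrow> 'a fps" where
  "theta_prod a b = qpoch (- a) (a * b) * qpoch (- b) (a * b) * qpoch (a * b) (a * b)"

section \<open>Ratios of consecutive theta terms\<close>

lemma theta_term_swap: "theta_term a b (- n) = theta_term b a n"
  by (simp add: theta_term_def algebra_simps)

lemma theta_term_succ_nat: "theta_term a b (int n + 1) = a * (a * b) ^ n * theta_term a b (int n)"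
proof -
  have 1: "nat ((int n + 1) * (int n + 1 + 1) div 2) = Suc n + nat (int n * (int n + 1) div 2)"
  proof -
    have "(int n + 1) * (int n + 1 + 1) = 2 * int (Suc n) + int n * (int n + 1)"
      by (simp add: algebra_simps)
    hence "(int n + 1) * (int n + 1 + 1) div 2 = int (Suc n) + int n * (int n + 1) div 2"
      by simp
    thus ?thesis by (simp add: nat_add_distrib)
  qed
  have 2: "nat ((int n + 1) * (int n + 1 - 1) div 2) = n + nat (int n * (int n - 1) div 2)"
  proof -
    have "(int n + 1) * (int n + 1 - 1) = 2 * int n + int n * (int n - 1)"
      by (simp add: algebra_simps)
    hence "(int n + 1) * (int n + 1 - 1) div 2 = int n + int n * (int n - 1) div 2"
      by simp
    moreover have "int n * (int n - 1) div 2 \<ge> 0" by (cases n) auto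
    ultimately show ?thesis by (simp add: nat_add_distrib)
  qed
  show ?thesis
    unfolding theta_term_def 1 2 by (simp add: power_add power_mult_distrib)
qed

text \<open>The ratio of consecutive terms is \<open>a * (a * b) ^ n\<close> with \<open>n\<close>
  possibly negative. Writing \<open>n\<close> as \<open>i - j\<close> and clearing
  \<open>(a * b) ^ j\<close> keeps all exponents natural.\<close>

lemma theta_term_succ:
  assumes "int i - int j = n"
  shows "(a * b) ^ j * theta_term a b (n + 1) = a * (a * b) ^ i * theta_term a b n"
proof (cases "n \<ge> 0")
  case True
  then obtain m where m: "n = int m" using nonneg_eq_int by blast
  hence "i = j + m" using assms by simp
  thus ?thesis unfolding m theta_term_succ_nat by (simp add: power_add)
next
  case False
  define m where "m = nat (- n - 1)"
  have m: "n = - (int m + 1)" using False by (simp add: m_def)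
  have j: "j = i + m + 1" using assms m by simp
  have "theta_term a b n = b * (a * b) ^ m * theta_term b a (int m)"
    unfolding m theta_term_swap theta_term_succ_nat by (simp add: mult.commute)
  moreover have "theta_term a b (n + 1) = theta_term b a (int m)"
    using theta_term_swap[of a b "int m"] by (simp add: m)
  ultimately show ?thesis by (simp add: j power_add algebra_simps)
qed

lemma theta_term_pred:
  assumes "int k - int N = n"
  shows "(a * b) ^ k * theta_term a b (n - 1) = b * (a * b) ^ N * theta_term a b n"
proof -
  have "(b * a) ^ k * theta_term b a (- n + 1) = b * (b * a) ^ N * theta_term b a (- n)"
    using assms by (intro theta_term_succ) auto
  moreover have "theta_term b a (- n + 1) = theta_term a b (n - 1)"
    using theta_term_swap[of b a "n - 1"] by simp
  ultimately show ?thesis by (simp add: theta_term_swap mult.commute)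
qed

section \<open>Gaussian binomials and the finite triple product\<close>

definition qbinom :: "'a::field fps \<Rightarrow> nat \<Rightarrow> nat \<Rightarrow> 'a fps" where
  "qbinom p A k = (if k \<le> A
     then qpoch_fin A p p * inverse (qpoch_fin k p p) * inverse (qpoch_fin (A - k) p p) else 0)"

lemma qpoch_fin_mult_inverse:
  fixes p :: "'a::field fps"
  assumes "p $ 0 = 0"
  shows "qpoch_fin n p p * inverse (qpoch_fin n p p) = 1"
proof -
  have "qpoch_fin n p p $ 0 = 1"
    by (induction n) (use assms in \<open>auto simp: qpoch_fin_Suc\<close>)
  thus ?thesis by (metis inverse_mult_eq_1' zero_neq_one)
qed

lemma inverse_qpoch_fin_Suc:
  fixes p :: "'a::field fps"
  assumes "p $ 0 = 0"
  shows "inverse (qpoch_fin n p p) = inverse (qpoch_fin (Suc n) p p) * (1 - p ^ Suc n)"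
proof -
  have "inverse (qpoch_fin (Suc n) p p) * (1 - p ^ Suc n) =
        (inverse (qpoch_fin n p p) * qpoch_fin n p p) *
           (inverse (qpoch_fin (Suc n) p p) * (1 - p ^ Suc n))"
    using qpoch_fin_mult_inverse[OF assms, of n] by (simp add: mult.commute)
  also have "\<dots> = inverse (qpoch_fin n p p) *
                (qpoch_fin (Suc n) p p * inverse (qpoch_fin (Suc n) p p))"
    by (simp add: qpoch_fin_Suc algebra_simps)
  finally show ?thesis using qpoch_fin_mult_inverse[OF assms, of "Suc n"] by simp
qed

lemma qbinom_0 [simp]: "p $ 0 = 0 \<Longrightarrow> qbinom p A 0 = 1"
  by (simp add: qbinom_def qpoch_fin_mult_inverse)

lemma qbinom_self [simp]: "p $ 0 = 0 \<Longrightarrow> qbinom p A A = 1"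
  by (simp add: qbinom_def qpoch_fin_mult_inverse)

lemma qbinom_gt [simp]: "k > A \<Longrightarrow> qbinom p A k = 0"
  by (simp add: qbinom_def)

text \<open>For \<open>k < A\<close> all three binomials are multiples of one product
  \<open>P * u * v\<close>, and both rules become identities in powers of \<open>p\<close>. The
  value 0 above \<open>A\<close> settles the boundary cases.\<close>

lemma qbinom_pascal:
  assumes "p $ 0 = 0"
  shows "qbinom p (Suc A) (Suc k) = qbinom p A k + p ^ Suc k * qbinom p A (Suc k)" (is ?th1)
    and "k \<le> A \<Longrightarrow> qbinom p (Suc A) (Suc k) = qbinom p A (Suc k) + p ^ (A - k) * qbinom p A k" (is "_ \<Longrightarrow> ?th2")
proof -
  consider "k < A" | "k = A" | "k > A" by linarith
  hence "?th1 \<and> (k \<le> A \<longrightarrow> ?th2)"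
  proof cases
    case 1
    then obtain j where A: "A = Suc (k + j)" using less_iff_Suc_add by auto
    define P where "P = qpoch_fin A p p"
    define u where "u = inverse (qpoch_fin (Suc k) p p)"
    define v where "v = inverse (qpoch_fin (Suc j) p p)"
    have a: "qbinom p A k = P * (u * (1 - p ^ Suc k)) * v"
      using inverse_qpoch_fin_Suc[OF assms, of k]
      by (simp add: qbinom_def A u_def v_def P_def Suc_diff_le)
    have b: "qbinom p A (Suc k) = P * u * (v * (1 - p ^ Suc j))"
      using inverse_qpoch_fin_Suc[OF assms, of j]
      by (simp add: qbinom_def A u_def v_def P_def)
    have c: "qbinom p (Suc A) (Suc k) = P * (1 - p ^ Suc A) * u * v"
      by (simp add: qbinom_def A u_def v_def P_def qpoch_fin_Suc[of "Suc _"])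
    show ?thesis unfolding a b c by (simp add: A algebra_simps power_add)
  qed (use assms in auto)
  thus ?th1 "k \<le> A \<Longrightarrow> ?th2" by auto
qed

text \<open>The Pascal rules in summed form: in the finite triple product the first absorbs a new
  factor with \<open>b\<close>, the second a new factor with \<open>a\<close>.\<close>

lemma sum_qbinom_Suc:
  assumes "p $ 0 = 0"
  shows "(\<Sum>k\<le>Suc A. qbinom p (Suc A) k * F k) =
           (\<Sum>k\<le>A. qbinom p A k * (F (Suc k) + p ^ k * F k))"
    and "(\<Sum>k\<le>Suc A. qbinom p (Suc A) k * F k) =
           (\<Sum>k\<le>A. qbinom p A k * (F k + p ^ (A - k) * F (Suc k)))"
proof -
  have shift: "(\<Sum>k\<le>A. qbinom p A (Suc k) * G (Suc k)) + G 0 = (\<Sum>k\<le>A. qbinom p A k * G k)" for G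
    using sum.atMost_Suc_shift[of "\<lambda>k. qbinom p A k * G k" A] assms by (simp add: add.commute)
  have "(\<Sum>k\<le>Suc A. qbinom p (Suc A) k * F k) =
        F 0 + (\<Sum>k\<le>A. qbinom p (Suc A) (Suc k) * F (Suc k))"
    by (subst sum.atMost_Suc_shift) (simp add: assms)
  also have "\<dots> = (\<Sum>k\<le>A. qbinom p A k * F (Suc k)) +
        ((\<Sum>k\<le>A. qbinom p A (Suc k) * (p ^ Suc k * F (Suc k))) + p ^ 0 * F 0)"
    by (simp add: qbinom_pascal(1)[OF assms] algebra_simps sum.distrib)
  also note shift[of "\<lambda>k. p ^ k * F k"]
  finally show "(\<Sum>k\<le>Suc A. qbinom p (Suc A) k * F k) =
           (\<Sum>k\<le>A. qbinom p A k * (F (Suc k) + p ^ k * F k))"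
    by (simp add: sum.distrib algebra_simps)
  have "(\<Sum>k\<le>Suc A. qbinom p (Suc A) k * F k) =
        F 0 + (\<Sum>k\<le>A. qbinom p (Suc A) (Suc k) * F (Suc k))"
    by (subst sum.atMost_Suc_shift) (simp add: assms)
  also have "\<dots> = (\<Sum>k\<le>A. qbinom p A k * (p ^ (A - k) * F (Suc k))) +
        ((\<Sum>k\<le>A. qbinom p A (Suc k) * F (Suc k)) + F 0)"
    by (simp add: qbinom_pascal(2)[OF assms] algebra_simps sum.distrib)
  also note shift[of F]
  finally show "(\<Sum>k\<le>Suc A. qbinom p (Suc A) k * F k) =
           (\<Sum>k\<le>A. qbinom p A k * (F k + p ^ (A - k) * F (Suc k)))"
    by (simp add: sum.distrib algebra_simps)
qed

text \<open>Induction on \<open>N\<close> for \<open>M = 0\<close>, then on \<open>M\<close>. A new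
  factor turns each theta term into itself plus a multiple of a neighbouring term, and the summed
  Pascal rules collect these.\<close>

lemma finite_jacobi_triple:
  fixes a b :: "'a::field fps"
  assumes p: "p = a * b" and [simp]: "p $ 0 = 0"
  shows "qpoch_fin M (- a) p * qpoch_fin N (- b) p =
           (\<Sum>k\<le>M + N. qbinom p (M + N) k * theta_term a b (int k - int N))"
proof (induction M)
  case 0
  show ?case
  proof (induction N)
    case 0
    show ?case by (simp add: theta_term_def)
  next
    case (Suc N)
    have "qpoch_fin 0 (- a) p * qpoch_fin (Suc N) (- b) p =
          (\<Sum>k\<le>N. qbinom p N k * theta_term a b (int k - int N)) * (1 + b * p ^ N)"
      using Suc by (simp add: qpoch_fin_Suc)
    also have "\<dots> = (\<Sum>k\<le>N. qbinom p N k * (theta_term a b (int k - int N)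
                        + p ^ k * theta_term a b (int k - int N - 1)))"
      unfolding sum_distrib_right
    proof (intro sum.cong refl)
      fix k
      have "p ^ k * theta_term a b (int k - int N - 1) = b * p ^ N * theta_term a b (int k - int N)"
        unfolding p by (rule theta_term_pred) simp
      thus "qbinom p N k * theta_term a b (int k - int N) * (1 + b * p ^ N) =
          qbinom p N k * (theta_term a b (int k - int N)
                        + p ^ k * theta_term a b (int k - int N - 1))"
        by (simp only: distrib_left distrib_right mult_1_left mult_1_right mult.assoc mult.commute mult.left_commute)
    qed
    also have "\<dots> = (\<Sum>k\<le>Suc N. qbinom p (Suc N) k * theta_term a b (int k - int (Suc N)))"
      by (subst sum_qbinom_Suc(1)) (auto simp: algebra_simps)
    finally show ?case by simp
  qed
next
  case (Suc M)
  have "qpoch_fin (Suc M) (- a) p * qpoch_fin N (- b) p =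
        (\<Sum>k\<le>M + N. qbinom p (M + N) k * theta_term a b (int k - int N)) * (1 + a * p ^ M)"
    unfolding Suc[symmetric] by (simp add: qpoch_fin_Suc algebra_simps)
  also have "\<dots> = (\<Sum>k\<le>M + N. qbinom p (M + N) k * (theta_term a b (int k - int N)
                      + p ^ (M + N - k) * theta_term a b (int (Suc k) - int N)))"
    unfolding sum_distrib_right
  proof (intro sum.cong refl)
    fix k assume "k \<in> {..M + N}"
    hence "(a * b) ^ (M + N - k) * theta_term a b ((int k - int N) + 1) =
             a * (a * b) ^ M * theta_term a b (int k - int N)"
      by (intro theta_term_succ) auto
    moreover have "int (Suc k) - int N = int k - int N + 1" by simp
    ultimately show "qbinom p (M + N) k * theta_term a b (int k - int N) * (1 + a * p ^ M) =
        qbinom p (M + N) k * (theta_term a b (int k - int N)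
                      + p ^ (M + N - k) * theta_term a b (int (Suc k) - int N))"
      by (simp add: p algebra_simps)
  qed
  also have "\<dots> = (\<Sum>k\<le>Suc M + N. qbinom p (Suc M + N) k * theta_term a b (int k - int N))"
    using sum_qbinom_Suc(2)[OF assms(2), of "M + N" "\<lambda>k. theta_term a b (int k - int N)"]
    by (simp only: add_Suc)
  finally show ?case .
qed

section \<open>Passage to the infinite triple product\<close>

lemma theta_term_agree_0:
  assumes "a $ 0 = 0" "b $ 0 = 0" "\<bar>n\<bar> \<ge> int K"
  shows "fps_agree K (theta_term a b n) 0"
proof (cases "n \<ge> 0")
  case True
  have "2 * n \<le> n * (n + 1)" using True by (cases "n = 0") (auto simp: algebra_simps)
  hence "K \<le> nat (n * (n + 1) div 2)" using assms(3) True by linarith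
  thus ?thesis unfolding theta_term_def
    by (intro fps_agree_mult_0(1) fps_agree_power_0 assms)
next
  case False
  have "2 * (- n) \<le> n * (n - 1)" using False mult_right_mono_neg[of "n - 1" "-2" n]
    by (auto simp: mult.commute)
  hence "K \<le> nat (n * (n - 1) div 2)" using assms(3) False by linarith
  thus ?thesis unfolding theta_term_def
    by (intro fps_agree_mult_0(2) fps_agree_power_0 assms)
qed

text \<open>As \<open>k\<close> and \<open>A - k\<close> grow, the Gaussian binomial tends to the
  inverse of the infinite product.\<close>

lemma qpoch_mult_qbinom_agree:
  fixes p :: "'a::field fps"
  assumes p: "p $ 0 = 0" and k: "K \<le> k" "k + K \<le> A"
  shows "fps_agree K (qpoch p p * qbinom p A k) 1"
proof -
  have inv: "fps_agree K (qpoch_fin n p p * inverse (qpoch_fin m p p)) 1" if "K \<le> n" "K \<le> m" for n m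
  proof -
    have "fps_agree K (qpoch_fin n p p) (qpoch_fin m p p)"
      using that qpoch_agree[OF p, of K] by (meson fps_agree_sym fps_agree_trans)
    hence "fps_agree K (qpoch_fin n p p * inverse (qpoch_fin m p p))
             (qpoch_fin m p p * inverse (qpoch_fin m p p))"
      by (intro fps_agree_mult) auto
    thus ?thesis by (simp add: qpoch_fin_mult_inverse[OF p])
  qed
  have "qpoch p p * qbinom p A k = qpoch p p *
      (inverse (qpoch_fin k p p) * (qpoch_fin A p p * inverse (qpoch_fin (A - k) p p)))"
    using k by (simp add: qbinom_def algebra_simps)
  also have "fps_agree K \<dots> (qpoch_fin K p p * (inverse (qpoch_fin k p p) * 1))"
    using k by (intro fps_agree_mult inv qpoch_agree p) auto
  also have "qpoch_fin K p p * (inverse (qpoch_fin k p p) * 1) =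
             qpoch_fin K p p * inverse (qpoch_fin k p p)" by simp
  also have "fps_agree K \<dots> 1" using k by (intro inv) auto
  finally show ?thesis .
qed

text \<open>The bounds \<open>M\<close> and \<open>N\<close> are independent because the parity
  dissection uses an asymmetric range.\<close>

lemma jacobi_triple_agree:
  fixes a b :: "'a::field fps"
  assumes a: "a $ 0 = 0" and b: "b $ 0 = 0" and M: "int K \<le> M" and N: "int K \<le> N"
  shows "fps_agree K (theta_prod a b) (\<Sum>n\<in>{-N..M}. theta_term a b n)"
proof -
  define p where "p = a * b"
  have p: "p $ 0 = 0" using a by (simp add: p_def)
  \<comment> \<open>With this \<open>L\<close>, every \<open>k\<close> with \<open>k - L\<close> in
    \<open>{-N..M}\<close> lies at least \<open>K\<close> away from both ends of the summation
    range, so its binomial may be replaced by the limit. All other theta terms already vanish below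
    order \<open>K\<close>.\<close>
  define L where "L = nat (M + N) + K"
  have L: "int L = M + N + int K" using M N by (simp add: L_def)
  have "fps_agree K (theta_prod a b)
     (qpoch_fin L (- a) p * qpoch_fin L (- b) p * qpoch p p)"
    unfolding theta_prod_def p_def[symmetric]
    by (intro fps_agree_mult qpoch_agree p) (use L M N in \<open>auto intro: order.refl\<close>)
  also have "qpoch_fin L (- a) p * qpoch_fin L (- b) p * qpoch p p =
     (\<Sum>k\<le>L + L. (qpoch p p * qbinom p (L + L) k) * theta_term a b (int k - int L))"
    by (simp add: finite_jacobi_triple[OF p_def p] sum_distrib_left sum_distrib_right mult_ac)
  also have "fps_agree K \<dots> (\<Sum>k\<le>L + L. if int k - int L \<in> {-N..M}
                                          then theta_term a b (int k - int L) else 0)"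
  proof (intro fps_agree_sum)
    fix k assume k: "k \<in> {..L + L}"
    show "fps_agree K (qpoch p p * qbinom p (L + L) k * theta_term a b (int k - int L))
           (if int k - int L \<in> {-N..M} then theta_term a b (int k - int L) else 0)"
    proof (cases "int k - int L \<in> {-N..M}")
      case True
      have "fps_agree K (qpoch p p * qbinom p (L + L) k * theta_term a b (int k - int L))
              (1 * theta_term a b (int k - int L))"
        using True M N L
        by (intro fps_agree_mult qpoch_mult_qbinom_agree p) auto
      thus ?thesis using True by simp
    next
      case False
      hence "fps_agree K (theta_term a b (int k - int L)) 0"
        using M N by (intro theta_term_agree_0 a b) auto
      thus ?thesis using False by (auto intro: fps_agree_mult_0)
    qed
  qed
  also have "(\<Sum>k\<le>L + L. if int k - int L \<in> {-N..M} then theta_term a b (int k - int L) else 0) =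
             (\<Sum>k\<in>{k\<in>{..L+L}. int k - int L \<in> {-N..M}}. theta_term a b (int k - int L))"
    by (rule sum.inter_filter[symmetric]) auto
  also have "\<dots> = (\<Sum>n\<in>{-N..M}. theta_term a b n)"
    using M N by (intro sum.reindex_bij_witness[of _ "\<lambda>n. nat (n + int L)" "\<lambda>k. int k - int L"])
       (use L in auto)
  finally show ?thesis .
qed

section \<open>Dissection of theta functions by parity\<close>

lemma theta_term_dissect:
  "theta_term a (a * c) (2 * n) = theta_term (a ^ 4 * c) (a ^ 4 * c ^ 3) n"
  "theta_term a (a * c) (2 * n + 1) = a * theta_term (a ^ 8 * c ^ 3) c n"
proof -
  \<comment> \<open>These triangular numbers satisfy \<open>n = r - s\<close> and
    \<open>n * n = r + s\<close>, so all exponents become linear in \<open>r\<close> and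
    \<open>s\<close>.\<close>
  define r where "r = nat (n * (n + 1) div 2)"
  define s where "s = nat (n * (n - 1) div 2)"
  have "even (n * (n + 1))" "even (n * (n - 1))" by auto
  moreover have "n * (n + 1) \<ge> 0" "n * (n - 1) \<ge> 0"
    by (cases "n \<ge> 0"; auto simp: zero_le_mult_iff)+
  ultimately have rs: "n * (n + 1) = 2 * int r" "n * (n - 1) = 2 * int s"
    by (auto simp: r_def s_def)
  hence nn: "n * n = int r + int s" "n = int r - int s" by (auto simp: algebra_simps)
  have 1: "nat (2 * n * (2 * n + 1) div 2) = 3 * r + s"
  proof -
    have "2 * n * (2 * n + 1) = 4 * (n * n) + 2 * n" by (simp add: algebra_simps)
    also have "\<dots> = 2 * int (3 * r + s)" unfolding nn(1) using nn(2) by simp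
    finally show ?thesis by simp
  qed
  have 2: "nat (2 * n * (2 * n - 1) div 2) = r + 3 * s"
  proof -
    have "2 * n * (2 * n - 1) = 4 * (n * n) - 2 * n" by (simp add: algebra_simps)
    also have "\<dots> = 2 * int (r + 3 * s)" unfolding nn(1) using nn(2) by simp
    finally show ?thesis by simp
  qed
  have 3: "nat ((2 * n + 1) * (2 * n + 1 - 1) div 2) = 3 * r + s"
    using 1 by (simp add: mult.commute)
  define e where "e = nat ((2 * n + 1) * (2 * n + 1 + 1) div 2)"
  \<comment> \<open>Here \<open>e\<close> is 5r - s + 1. Adding the power \<open>3 * r + s\<close>
    of \<open>a\<close> that comes from the second argument \<open>a * c\<close> avoids subtraction
    of naturals.\<close>
  have 4: "e + (3 * r + s) = 8 * r + 1"
  proof -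
    have "(2 * n + 1) * (2 * n + 1 + 1) = 2 * (2 * (n * n) + 3 * n + 1)"
      by (simp add: algebra_simps)
    hence "(2 * n + 1) * (2 * n + 1 + 1) div 2 = 2 * (n * n) + 3 * n + 1" by simp
    moreover have "2 * (n * n) + 3 * n + 1 \<ge> 0"
    proof -
      have "(2 * n + 1) * (n + 1) \<ge> 0" by (cases "n \<ge> 0") (auto simp: zero_le_mult_iff)
      thus ?thesis by (simp add: algebra_simps)
    qed
    ultimately have "int e = 2 * (n * n) + 3 * n + 1" unfolding e_def by simp
    hence "int e = 2 * (int r + int s) + 3 * n + 1" unfolding nn(1) .
    hence "int (e + (3 * r + s)) = int (8 * r + 1)" using nn(2) by simp
    thus ?thesis by (simp only: of_nat_eq_iff)
  qed
  show "theta_term a (a * c) (2 * n) = theta_term (a ^ 4 * c) (a ^ 4 * c ^ 3) n"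
    unfolding theta_term_def 1 2 r_def[symmetric] s_def[symmetric]
  proof -
    have "a ^ (3 * r + s) * (a * c) ^ (r + 3 * s) = a ^ ((3 * r + s) + (r + 3 * s)) * c ^ (r + 3 * s)"
      by (simp only: power_mult_distrib power_add mult_ac)
    also have "(3 * r + s) + (r + 3 * s) = 4 * r + 4 * s" by simp
    also have "a ^ (4 * r + 4 * s) * c ^ (r + 3 * s) = (a ^ 4 * c) ^ r * (a ^ 4 * c ^ 3) ^ s"
      by (simp add: power_mult_distrib power_mult[symmetric] power_add mult_ac)
    finally show "a ^ (3 * r + s) * (a * c) ^ (r + 3 * s) = (a ^ 4 * c) ^ r * (a ^ 4 * c ^ 3) ^ s" .
  qed
  have "theta_term a (a * c) (2 * n + 1) = a ^ (e + (3 * r + s)) * c ^ (3 * r + s)"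
    unfolding theta_term_def 3 e_def[symmetric] by (simp add: power_mult_distrib power_add)
  also have "\<dots> = a * theta_term (a ^ 8 * c ^ 3) c n"
    unfolding 4 theta_term_def r_def[symmetric] s_def[symmetric]
    by (simp add: power_mult_distrib power_mult[symmetric] power_add)
  finally show "theta_term a (a * c) (2 * n + 1) = a * theta_term (a ^ 8 * c ^ 3) c n" .
qed

text \<open>The extra index on the right lets the even and odd parts run over the same symmetric
  range.\<close>

lemma sum_dissect:
  fixes F :: "int \<Rightarrow> 'a::comm_monoid_add"
  shows "(\<Sum>n\<in>{- (2 * int N)..2 * int N + 1}. F n) =
           (\<Sum>n\<in>{-int N..int N}. F (2 * n)) + (\<Sum>n\<in>{-int N..int N}. F (2 * n + 1))"
proof -
  have "(\<Sum>n\<in>{- (2 * int N)..2 * int N + 1}. F n) =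
          (\<Sum>n\<in>(\<lambda>n. 2 * n) ` {-int N..int N} \<union> (\<lambda>n. 2 * n + 1) ` {-int N..int N}. F n)"
  proof (rule sum.cong)
    show "{- (2 * int N)..2 * int N + 1} =
       (\<lambda>n. 2 * n) ` {-int N..int N} \<union> (\<lambda>n. 2 * n + 1) ` {-int N..int N}" (is "?A = ?B")
    proof (intro equalityI subsetI)
      fix n assume "n \<in> ?A"
      thus "n \<in> ?B" by (cases "even n") (auto elim!: evenE oddE)
    qed auto
  qed auto
  also have "\<dots> = (\<Sum>n\<in>(\<lambda>n. 2 * n) ` {-int N..int N}. F n) +
                (\<Sum>n\<in>(\<lambda>n. 2 * n + 1) ` {-int N..int N}. F n)"
    by (intro sum.union_disjoint) (auto, presburger)
  finally show ?thesis by (simp add: sum.reindex inj_on_def)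
qed

text \<open>Ramanujan's f(a,b) = f(a^3 b, a b^3) + a f(a^5 b^3, b/a); writing b as
  \<open>a * c\<close> makes b/a a power series.\<close>

lemma theta_prod_dissect:
  fixes a c :: "'a::field fps"
  assumes a: "a $ 0 = 0" and c: "c $ 0 = 0"
  shows "theta_prod a (a * c) =
           theta_prod (a ^ 4 * c) (a ^ 4 * c ^ 3) + a * theta_prod (a ^ 8 * c ^ 3) c"
proof (rule fps_eqI_agree)
  fix K
  have "fps_agree K (theta_prod a (a * c)) (\<Sum>n\<in>{-(2 * int K)..2 * int K + 1}. theta_term a (a * c) n)"
    by (rule jacobi_triple_agree) (use a in auto)
  also have "(\<Sum>n\<in>{-(2 * int K)..2 * int K + 1}. theta_term a (a * c) n) =
      (\<Sum>n\<in>{-int K..int K}. theta_term (a ^ 4 * c) (a ^ 4 * c ^ 3) n) +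
      a * (\<Sum>n\<in>{-int K..int K}. theta_term (a ^ 8 * c ^ 3) c n)"
    unfolding sum_dissect theta_term_dissect by (simp add: sum_distrib_left)
  also have "fps_agree K \<dots>
      (theta_prod (a ^ 4 * c) (a ^ 4 * c ^ 3) + a * theta_prod (a ^ 8 * c ^ 3) c)"
    by (intro fps_agree_add fps_agree_mult fps_agree_sym[OF jacobi_triple_agree])
       (use a c in auto)
  finally show "fps_agree K (theta_prod a (a * c))
      (theta_prod (a ^ 4 * c) (a ^ 4 * c ^ 3) + a * theta_prod (a ^ 8 * c ^ 3) c)" .
qed

section \<open>Euler's product and theta functions expressed by it\<close>

definition euler :: "'a::idom fps \<Rightarrow> 'a fps" where
  "euler u = qpoch u u"

text \<open>Trades the limit in \<open>Eta\<close> for the coefficientwise product, whose argument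
  may also be \<open>- fps_X\<close>.\<close>

lemma Eta_eq_euler:
  assumes "k > 0"
  shows "Eta k = euler (fps_X ^ k)"
proof -
  have "(\<Prod>m\<in>{1..N}. 1 - fps_X ^ (k * m)) = qpoch_fin N (fps_X ^ k) (fps_X ^ k :: rat fps)" for N
    unfolding qpoch_fin_def One_nat_def prod.atLeast1_atMost_eq
    by (simp add: power_add power_mult)
  moreover have "(\<lambda>N. qpoch_fin N (fps_X ^ k) (fps_X ^ k :: rat fps)) \<longlonglongrightarrow> euler (fps_X ^ k)"
  proof (rule tendsto_fpsI)
    fix n
    show "\<forall>\<^sub>F N in sequentially.
            qpoch_fin N (fps_X ^ k) (fps_X ^ k :: rat fps) $ n = euler (fps_X ^ k) $ n"
      using eventually_ge_at_top[of "Suc n"]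
    proof eventually_elim
      case (elim N)
      thus ?case
        using qpoch_agree[of "fps_X ^ k :: rat fps" "Suc n" N "fps_X ^ k"] assms
        by (auto simp: fps_agree_def euler_def)
    qed
  qed
  ultimately show ?thesis unfolding Eta_def by (simp add: limI)
qed

lemma euler_nth_0: "u $ 0 = 0 \<Longrightarrow> euler u $ 0 = 1"
  by (simp add: euler_def qpoch_nth_0)

lemma euler_compose: "u $ 0 = 0 \<Longrightarrow> w $ 0 = 0 \<Longrightarrow> euler u oo w = euler (u oo w)"
  by (simp add: euler_def qpoch_compose)

lemma euler_nonzero: "u $ 0 = 0 \<Longrightarrow> euler u \<noteq> 0"
  using euler_nth_0[of u] by auto

lemma euler_eq_odd:
  assumes "u $ 0 = 0"
  shows "euler u = qpoch u (u ^ 2) * euler (u ^ 2)"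
  using qpoch_split[of u 2 u] assms by (simp add: euler_def numeral_2_eq_2)

lemma euler_eq_3:
  assumes "u $ 0 = 0"
  shows "euler u = qpoch u (u ^ 3) * qpoch (u ^ 2) (u ^ 3) * euler (u ^ 3)"
  using qpoch_split[of u 3 u] assms by (simp add: euler_def numeral_3_eq_3 numeral_2_eq_2)

text \<open>The classical E(-q) = E(q^2)^3 / (E(q) E(q^4)), free of division.\<close>

lemma euler_uminus:
  assumes u: "u $ 0 = 0"
  shows "euler (- u) * (euler u * euler (u ^ 4)) = euler (u ^ 2) ^ 3"
proof -
  let ?P = "qpoch u (u ^ 2)" and ?N = "qpoch (- u) (u ^ 2)"
  have 1: "euler (- u) = ?N * euler (u ^ 2)"
    using euler_eq_odd[of "- u"] u by simp
  have 2: "euler u = ?P * euler (u ^ 2)"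
    by (rule euler_eq_odd) fact
  have 3: "?P * ?N = qpoch (u ^ 2) (u ^ 4)"
    using qpoch_mult_uminus[of "u ^ 2" u] u by (simp add: power_mult[symmetric])
  have 4: "qpoch (u ^ 2) (u ^ 4) * euler (u ^ 4) = euler (u ^ 2)"
    using euler_eq_odd[of "u ^ 2"] u by (simp add: power_mult[symmetric])
  have "euler (- u) * (euler u * euler (u ^ 4)) = (?P * ?N) * euler (u ^ 4) * euler (u ^ 2) ^ 2"
    unfolding 1 2 by (simp only: power2_eq_square mult_ac)
  thus ?thesis unfolding 3 4 by (simp only: power3_eq_cube power2_eq_square mult.assoc)
qed

lemma theta_prod_pentagonal:
  assumes "u $ 0 = 0"
  shows "theta_prod (- u) (- (u ^ 2)) = euler u"
  using euler_eq_3[OF assms]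
  by (simp add: theta_prod_def euler_def power3_eq_cube power2_eq_square mult.assoc)

text \<open>Supplying the missing residue class modulo 3 completes the product to
  \<open>qpoch (- u) u\<close>, which is E(u^2) / E(u).\<close>

lemma theta_prod_square:
  assumes u: "u $ 0 = 0"
  shows "theta_prod u (u ^ 2) * (euler u * euler (u ^ 6)) = euler (u ^ 2) * euler (u ^ 3) ^ 2"
proof -
  have t: "theta_prod u (u ^ 2) = qpoch (- u) (u ^ 3) * qpoch (- (u ^ 2)) (u ^ 3) * euler (u ^ 3)"
    by (simp add: theta_prod_def euler_def power3_eq_cube power2_eq_square mult.assoc)
  let ?a = "qpoch (- u) (u ^ 3) * qpoch (- (u ^ 2)) (u ^ 3)" and ?m = "qpoch (- (u ^ 3)) (u ^ 3)"
  have 1: "?a * ?m = qpoch (- u) u"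
    using qpoch_split[of u 3 "- u"] u
    by (simp add: numeral_3_eq_3 numeral_2_eq_2 mult.assoc)
  have 2: "qpoch (- u) u * euler u = euler (u ^ 2)"
    using qpoch_mult_uminus[of u u] u by (simp add: euler_def mult.commute)
  have 3: "?m * euler (u ^ 3) = euler (u ^ 6)"
    using qpoch_mult_uminus[of "u ^ 3" "u ^ 3"] u
    by (simp add: euler_def mult.commute power_mult[symmetric])
  have "theta_prod u (u ^ 2) * (euler u * euler (u ^ 6)) =
          (?a * ?m) * euler u * euler (u ^ 3) ^ 2"
    unfolding t 3[symmetric] by (simp only: power2_eq_square mult_ac)
  thus ?thesis by (simp only: 1 2)
qed

text \<open>The classes 1, 5, 7, 11 modulo 12 are the odd ones without the odd multiples of
  3.\<close>

lemma theta_prod_mod_12: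
  assumes u: "u $ 0 = 0"
  shows "theta_prod (- (u ^ 5)) (- (u ^ 7)) * theta_prod (- (u ^ 11)) (- u) *
           (euler (u ^ 2) * euler (u ^ 3)) = euler u * euler (u ^ 6) * euler (u ^ 12) ^ 2"
proof -
  let ?Q = "\<lambda>n. qpoch (u ^ n) (u ^ 12)"
  have t: "theta_prod (- (u ^ 5)) (- (u ^ 7)) = ?Q 5 * ?Q 7 * euler (u ^ 12)"
          "theta_prod (- (u ^ 11)) (- u) = ?Q 11 * ?Q 1 * euler (u ^ 12)"
    by (simp_all add: theta_prod_def euler_def flip: power_add power_Suc2)
  have "qpoch u (u ^ 2) = ?Q 1 * ?Q 3 * ?Q 5 * ?Q 7 * ?Q 9 * ?Q 11"
    using qpoch_split[of "u ^ 2" 6 u] u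
    by (simp add: eval_nat_numeral mult_ac)
  moreover have "qpoch (u ^ 3) (u ^ 6) = ?Q 3 * ?Q 9"
    using qpoch_split[of "u ^ 6" 2 "u ^ 3"] u
    by (simp add: numeral_2_eq_2 flip: power_add power_mult)
  moreover have "euler u = qpoch u (u ^ 2) * euler (u ^ 2)"
    by (rule euler_eq_odd) fact
  moreover have "euler (u ^ 3) = qpoch (u ^ 3) (u ^ 6) * euler (u ^ 6)"
    using euler_eq_odd[of "u ^ 3"] u by (simp add: power_mult[symmetric])
  ultimately show ?thesis unfolding t by (simp add: power2_eq_square mult_ac)
qed

lemma Eta_nth_0: "n > 0 \<Longrightarrow> Eta n $ 0 = 1"
  by (simp add: Eta_eq_euler euler_nth_0)

lemma Eta_compose_square: "n > 0 \<Longrightarrow> Eta n oo fps_X ^ 2 = Eta (2 * n)"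
  by (simp add: Eta_eq_euler euler_compose fps_compose_power[symmetric] power_mult)

lemma Eta_compose_uminus_even: "n > 0 \<Longrightarrow> even n \<Longrightarrow> Eta n oo - fps_X = Eta n"
  by (simp add: Eta_eq_euler euler_compose fps_compose_power[symmetric])

lemma Eta_compose_uminus_odd:
  assumes "odd n"
  shows "(Eta n oo - fps_X) * (Eta n * Eta (4 * n)) = Eta (2 * n) ^ 3"
proof -
  have "n > 0" using assms by (rule odd_pos)
  hence "Eta n oo - fps_X = euler (- (fps_X ^ n))"
    using assms by (simp add: Eta_eq_euler euler_compose fps_compose_power[symmetric])
  thus ?thesis using euler_uminus[of "fps_X ^ n :: rat fps"] \<open>n > 0\<close>
    by (simp add: Eta_eq_euler power_mult[symmetric] mult.commute)
qed

text \<open>Identities between eta quotients are checked in the field of Laurent series, where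
  \<open>field_simps\<close> can clear denominators.\<close>

lemma fps_to_fls_inverse:
  "f $ 0 \<noteq> 0 \<Longrightarrow> fps_to_fls (inverse f) = inverse (fps_to_fls (f :: 'a::field fps))"
  by (simp add: fls_inverse_fps_to_fls subdegree_eq_0)

lemma Eta_nonzero: "n > 0 \<Longrightarrow> Eta n \<noteq> 0"
  by (simp add: Eta_eq_euler euler_nonzero)

section \<open>Eta quotients of level 12\<close>

text \<open>The hauptmodul \<open>x\<close> of level 12 and eta quotients that will turn out to be
  \<open>1 - x\<close>, \<open>1 + x\<close>, \<open>1 + 3x\<close> and \<open>1 - 3x\<close>.\<close>

definition xx :: "rat fps" where
  "xx = fps_X * (Eta 2 ^ 2 * Eta 12 ^ 4 * inverse (Eta 4 ^ 4 * Eta 6 ^ 2))"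

definition qB :: "rat fps" where
  "qB = Eta 1 * Eta 6 ^ 7 * inverse (Eta 2 * Eta 3 ^ 3 * Eta 4 ^ 2 * Eta 12 ^ 2)"

definition qG :: "rat fps" where
  "qG = Eta 3 ^ 3 * Eta 2 ^ 2 * Eta 12 * inverse (Eta 1 * Eta 4 ^ 3 * Eta 6 ^ 2)"

definition qA :: "rat fps" where
  "qA = Eta 2 ^ 9 * Eta 3 * Eta 12 ^ 2 * inverse (Eta 1 ^ 3 * Eta 4 ^ 6 * Eta 6 ^ 3)"

definition qD :: "rat fps" where
  "qD = Eta 1 ^ 3 * Eta 12 * inverse (Eta 3 * Eta 4 ^ 3)"

lemma q_nth_0: "xx $ 0 = 0" "qB $ 0 = 1" "qG $ 0 = 1" "qA $ 0 = 1" "qD $ 0 = 1"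
  by (simp_all add: xx_def qB_def qG_def qA_def qD_def Eta_nth_0 fps_power_zeroth)

lemma xx_nonzero: "xx \<noteq> 0"
proof -
  have "(Eta 2 ^ 2 * Eta 12 ^ 4 * inverse (Eta 4 ^ 4 * Eta 6 ^ 2)) $ 0 = 1"
    by (simp add: Eta_nth_0 fps_power_zeroth)
  hence "Eta 2 ^ 2 * Eta 12 ^ 4 * inverse (Eta 4 ^ 4 * Eta 6 ^ 2) \<noteq> 0"
    by (metis fps_zero_nth zero_neq_one)
  thus ?thesis unfolding xx_def by (metis fps_X_neq_zero mult_eq_0_iff)
qed

lemmas to_fls = fls_times_fps_to_fls fps_to_fls_power fps_to_fls_inverse Eta_nth_0
  fps_power_zeroth

lemma fls_xx: "fps_to_fls xx = fls_X * fps_to_fls (Eta 2) ^ 2 * fps_to_fls (Eta 12) ^ 4 /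
    (fps_to_fls (Eta 4) ^ 4 * fps_to_fls (Eta 6) ^ 2)"
  by (simp add: xx_def to_fls divide_inverse)

lemma fls_qB: "fps_to_fls qB = fps_to_fls (Eta 1) * fps_to_fls (Eta 6) ^ 7 /
    (fps_to_fls (Eta 2) * fps_to_fls (Eta 3) ^ 3 * fps_to_fls (Eta 4) ^ 2 * fps_to_fls (Eta 12) ^ 2)"
  unfolding qB_def by (simp only: to_fls divide_inverse) (simp add: to_fls)

lemma fls_qG: "fps_to_fls qG = fps_to_fls (Eta 3) ^ 3 * fps_to_fls (Eta 2) ^ 2 * fps_to_fls (Eta 12) /
    (fps_to_fls (Eta 1) * fps_to_fls (Eta 4) ^ 3 * fps_to_fls (Eta 6) ^ 2)"
  by (simp add: qG_def to_fls divide_inverse)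

lemma fls_qA: "fps_to_fls qA = fps_to_fls (Eta 2) ^ 9 * fps_to_fls (Eta 3) * fps_to_fls (Eta 12) ^ 2 /
    (fps_to_fls (Eta 1) ^ 3 * fps_to_fls (Eta 4) ^ 6 * fps_to_fls (Eta 6) ^ 3)"
  by (simp add: qA_def to_fls divide_inverse)

lemma fls_qD: "fps_to_fls qD = fps_to_fls (Eta 1) ^ 3 * fps_to_fls (Eta 12) /
    (fps_to_fls (Eta 3) * fps_to_fls (Eta 4) ^ 3)"
  by (simp add: qD_def to_fls divide_inverse)

lemmas fls_q = fls_xx fls_qB fls_qG fls_qA fls_qD

text \<open>The only input from theta functions. S = f(q,-q^2) and D = f(-q,q^2) dissect into A5 + q
  A1 and A5 - q A1, so S^2 - D^2 = 4q A5 A1, and S, D and A5 A1 are eta quotients.\<close>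

lemma qA_minus_qB: "qA - qB = 4 * xx"
proof -
  define S where "S = theta_prod fps_X (- (fps_X ^ 2) :: rat fps)"
  define D where "D = theta_prod (- fps_X) (fps_X ^ 2 :: rat fps)"
  define A5 where "A5 = theta_prod (- (fps_X ^ 5)) (- (fps_X ^ 7) :: rat fps)"
  define A1 where "A1 = theta_prod (- (fps_X ^ 11)) (- fps_X :: rat fps)"
  have S1: "S = A5 + fps_X * A1"
    using theta_prod_dissect[of fps_X "- fps_X :: rat fps"]
    by (simp add: S_def A5_def A1_def power2_eq_square eval_nat_numeral mult.assoc)
  have D1: "D = A5 - fps_X * A1"
    using theta_prod_dissect[of "- fps_X" "- fps_X :: rat fps"]
    by (simp add: D_def A5_def A1_def power2_eq_square eval_nat_numeral mult.assoc)
  have SD: "S ^ 2 - D ^ 2 = 4 * fps_X * (A5 * A1)"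
    unfolding S1 D1 by (simp add: power2_eq_square algebra_simps)
  have u1: "euler (- fps_X) * (Eta 1 * Eta 4) = Eta 2 ^ 3"
    using euler_uminus[of "fps_X :: rat fps"] by (simp add: Eta_eq_euler)
  have u3: "euler (- (fps_X ^ 3)) * (Eta 3 * Eta 12) = Eta 6 ^ 3"
    using euler_uminus[of "fps_X ^ 3 :: rat fps"] by (simp add: Eta_eq_euler flip: power_mult)
  have S2: "S = euler (- fps_X)"
    using theta_prod_pentagonal[of "- fps_X :: rat fps"] by (simp add: S_def)
  have D2: "D * (euler (- fps_X) * Eta 6) = Eta 2 * euler (- (fps_X ^ 3)) ^ 2"
    using theta_prod_square[of "- fps_X :: rat fps"] by (simp add: D_def Eta_eq_euler)
  have T2: "A5 * A1 * (Eta 2 * Eta 3) = Eta 1 * Eta 6 * Eta 12 ^ 2"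
    using theta_prod_mod_12[of "fps_X :: rat fps"] by (simp add: A5_def A1_def Eta_eq_euler)
  let ?h = "fps_to_fls :: rat fps \<Rightarrow> rat fls"
  define e1 e2 e3 e4 e6 e12 where es: "e1 = ?h (Eta 1)" "e2 = ?h (Eta 2)" "e3 = ?h (Eta 3)"
    "e4 = ?h (Eta 4)" "e6 = ?h (Eta 6)" "e12 = ?h (Eta 12)"
  have nz: "e1 \<noteq> 0" "e2 \<noteq> 0" "e3 \<noteq> 0" "e4 \<noteq> 0" "e6 \<noteq> 0" "e12 \<noteq> 0"
    unfolding es by (simp_all add: Eta_nonzero)
  have m1: "?h (euler (- fps_X)) = e2 ^ 3 / (e1 * e4)"
    using arg_cong[OF u1, of ?h] nz by (simp add: to_fls es field_simps del: One_nat_def)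
  have m3: "?h (euler (- (fps_X ^ 3))) = e6 ^ 3 / (e3 * e12)"
    using arg_cong[OF u3, of ?h] nz by (simp add: to_fls es field_simps del: One_nat_def)
  have hS: "?h S = e2 ^ 3 / (e1 * e4)"
    unfolding S2 m1 ..
  have "?h D * (e2 ^ 3 / (e1 * e4) * e6) = e2 * (e6 ^ 3 / (e3 * e12)) ^ 2"
    using arg_cong[OF D2, of ?h] by (simp add: to_fls m1 m3 es[symmetric] del: One_nat_def)
  hence hD: "?h D = e1 * e4 * e6 ^ 5 / (e2 ^ 2 * e3 ^ 2 * e12 ^ 2)"
    using nz by (simp add: field_simps power2_eq_square eval_nat_numeral)
  have hT: "?h (A5 * A1) = e1 * e6 * e12 ^ 2 / (e2 * e3)"
    using arg_cong[OF T2, of ?h] nz by (simp add: to_fls es[symmetric] field_simps del: One_nat_def)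
  \<comment> \<open>The common factor: dividing S^2, D^2 and q A5 A1 by it leaves \<open>qA\<close>,
    \<open>qB\<close> and \<open>xx\<close>.\<close>
  define M where "M = e1 * e4 ^ 4 * e6 ^ 3 / (e2 ^ 3 * e3 * e12 ^ 2)"
  have M: "M \<noteq> 0" using nz by (simp add: M_def)
  have "?h S ^ 2 = ?h qA * M"
    unfolding hS fls_qA es[symmetric] M_def using nz
    by (simp add: field_simps eval_nat_numeral)
  moreover have "?h D ^ 2 = ?h qB * M"
    unfolding hD fls_qB es[symmetric] M_def using nz
    by (simp add: field_simps eval_nat_numeral)
  moreover have "fls_X * ?h (A5 * A1) = ?h xx * M"
    unfolding hT fls_xx es[symmetric] M_def using nz
    by (simp add: field_simps eval_nat_numeral)
  moreover have "?h S ^ 2 - ?h D ^ 2 = 4 * (fls_X * ?h (A5 * A1))"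
    using arg_cong[OF SD, of ?h] by (simp add: to_fls mult.assoc)
  ultimately have "(?h qA - ?h qB) * M = (4 * ?h xx) * M"
    by (simp add: algebra_simps)
  hence "?h (qA - qB) = ?h (4 * xx)" using M by (simp add: to_fls)
  thus ?thesis by (rule fps_to_fls_eq_imp_fps_eq)
qed

section \<open>Eta quotients for \<open>xi\<close> and \<open>kappa\<close>, and the substitution of
  q^2 for q\<close>

lemma xi_eq: "xi = Eta 2 ^ 5 * Eta 6 * inverse (Eta 1 * Eta 3 ^ 5)"
  by (simp add: xi_def Eta_eq_euler)

lemma xi_nth_0: "xi $ 0 = 1"
  by (simp add: xi_eq Eta_nth_0 fps_power_zeroth)

lemma fls_xi: "fps_to_fls xi = fps_to_fls (Eta 2) ^ 5 * fps_to_fls (Eta 6) /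
    (fps_to_fls (Eta 1) * fps_to_fls (Eta 3) ^ 5)"
  by (simp add: xi_eq to_fls divide_inverse)

lemma fps_inverse_compose_square:
  "f $ 0 \<noteq> 0 \<Longrightarrow> inverse f oo fps_X ^ 2 = inverse (f oo fps_X ^ 2 :: rat fps)"
  by (rule fps_inverse_compose) auto

lemmas compose_square = fps_compose_mult_distrib fps_compose_power[symmetric]
  Eta_compose_square fps_inverse_compose_square Eta_nth_0 fps_power_zeroth

definition xi_sq :: "rat fps" where
  "xi_sq = xi oo fps_X ^ 2"

lemma xi_sq_eq: "xi_sq = Eta 4 ^ 5 * Eta 12 * inverse (Eta 2 * Eta 6 ^ 5)"
  by (simp add: xi_sq_def xi_eq compose_square)

lemma fls_xi_sq: "fps_to_fls xi_sq = fps_to_fls (Eta 4) ^ 5 * fps_to_fls (Eta 12) /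
    (fps_to_fls (Eta 2) * fps_to_fls (Eta 6) ^ 5)"
  by (simp add: xi_sq_eq to_fls divide_inverse)

lemma xi_qG: "xi * qG ^ 2 = qA"
  by (rule fps_to_fls_eq_imp_fps_eq)
     (simp add: to_fls fls_xi fls_q Eta_nonzero field_simps power_numeral_reduce)

lemma xi_sq_qB_qG: "xi_sq * (qB * qG) = 1"
  by (rule fps_to_fls_eq_imp_fps_eq)
     (simp add: to_fls fls_xi_sq fls_q Eta_nonzero field_simps power_numeral_reduce)

lemma kappa_eq: "kappa = (xi_sq * qG) ^ 5"
proof -
  have g1: "fps_to_fls (gam 1) = fps_to_fls (Eta 1) ^ 5 * fps_to_fls (Eta 2) ^ 5 * fps_to_fls (Eta 6) ^ 5
               / fps_to_fls (Eta 3) ^ 15"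
    unfolding gam_def
    by (simp add: to_fls divide_inverse del: One_nat_def)
  have g2: "fps_to_fls (gam 2) = fps_to_fls (Eta 2) ^ 5 * fps_to_fls (Eta 4) ^ 5 * fps_to_fls (Eta 12) ^ 5
               / fps_to_fls (Eta 6) ^ 15"
    unfolding gam_def
    by (simp add: to_fls divide_inverse del: One_nat_def)
  have g0: "gam 1 $ 0 = 1"
    unfolding gam_def
    by (simp add: Eta_nth_0 fps_power_zeroth del: One_nat_def)
  have "fps_to_fls kappa = fps_to_fls (gam 2) ^ 2 / fps_to_fls (gam 1)"
    by (simp add: kappa_def to_fls g0 divide_inverse del: One_nat_def)
  also have "\<dots> = (fps_to_fls xi_sq * fps_to_fls qG) ^ 5"
    unfolding g1 g2 fls_xi_sq fls_q
    by (simp add: Eta_nonzero field_simps power_mult_distrib power_divide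
        flip: power_mult power_add)
  finally show ?thesis
    by (intro fps_to_fls_eq_imp_fps_eq) (simp add: to_fls)
qed

text \<open>Only eta functions of even index survive in \<open>qA * qD\<close>, so it is a series in
  q^2. With \<open>xx_power2\<close> and \<open>qB_qG\<close> this feeds the rigidity
  arguments.\<close>

lemma qA_qD: "qA * qD = (qD ^ 2 * inverse qA) oo fps_X ^ 2"
proof -
  have "qD ^ 2 * inverse qA = Eta 1 ^ 9 * Eta 6 ^ 3 * inverse (Eta 2 ^ 9 * Eta 3 ^ 3)"
    by (rule fps_to_fls_eq_imp_fps_eq)
       (simp add: to_fls fls_q q_nth_0 Eta_nonzero field_simps power_numeral_reduce)
  moreover have "\<dots> oo fps_X ^ 2 = Eta 2 ^ 9 * Eta 12 ^ 3 * inverse (Eta 4 ^ 9 * Eta 6 ^ 3)"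
    by (simp add: compose_square)
  moreover have "\<dots> = qA * qD"
    by (rule fps_to_fls_eq_imp_fps_eq)
       (simp add: to_fls fls_q q_nth_0 Eta_nonzero field_simps power_numeral_reduce)
  ultimately show ?thesis by simp
qed

lemma xx_power2: "xx ^ 2 = (xx * qB * inverse qA) oo fps_X ^ 2"
proof -
  have "xx * qB * inverse qA = fps_X * (Eta 1 ^ 4 * Eta 6 ^ 8 * inverse (Eta 2 ^ 8 * Eta 3 ^ 4))"
    by (rule fps_to_fls_eq_imp_fps_eq)
       (simp add: to_fls fls_q q_nth_0 Eta_nonzero field_simps power_numeral_reduce)
  moreover have "\<dots> oo fps_X ^ 2 =
      fps_X ^ 2 * (Eta 2 ^ 4 * Eta 12 ^ 8 * inverse (Eta 4 ^ 8 * Eta 6 ^ 4))"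
    by (simp add: compose_square)
  moreover have "\<dots> = xx ^ 2"
    by (rule fps_to_fls_eq_imp_fps_eq)
       (simp add: to_fls fls_q q_nth_0 Eta_nonzero field_simps power_numeral_reduce)
  ultimately show ?thesis by simp
qed

text \<open>Both sides are inverse to \<open>xi_sq\<close>.\<close>

lemma qB_qG: "qB * qG = (qG ^ 2 * inverse qA) oo fps_X ^ 2"
proof -
  have "(qG ^ 2 * inverse qA) * xi = 1"
  proof -
    have "(qG ^ 2 * inverse qA) * xi = (xi * qG ^ 2) * inverse qA" by (simp only: mult_ac)
    thus ?thesis by (simp add: xi_qG inverse_mult_eq_1' q_nth_0)
  qed
  hence "((qG ^ 2 * inverse qA) oo fps_X ^ 2) * (xi oo fps_X ^ 2) = 1"
    by (metis fps_compose_1 fps_compose_mult_distrib fps_X_power_nth zero_neq_numeral)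
  hence 1: "xi_sq * ((qG ^ 2 * inverse qA) oo fps_X ^ 2) = 1"
    by (simp only: xi_sq_def mult.commute)
  hence "xi_sq \<noteq> 0" by auto
  thus ?thesis using xi_sq_qB_qG 1 by (metis mult_left_cancel)
qed

section \<open>The substitution of -q for q\<close>

lemma fps_inverse_compose_uminus:
  "f $ 0 \<noteq> 0 \<Longrightarrow> inverse f oo - fps_X = inverse (f oo - fps_X :: rat fps)"
  by (rule fps_inverse_compose) auto

lemmas compose_uminus = fps_compose_mult_distrib fps_compose_power[symmetric]
  Eta_compose_uminus_even fps_inverse_compose_uminus Eta_nth_0 fps_power_zeroth

lemma Eta_uminus_fls:
  "fps_to_fls (Eta 1 oo - fps_X) = fps_to_fls (Eta 2) ^ 3 / (fps_to_fls (Eta 1) * fps_to_fls (Eta 4))"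
  "fps_to_fls (Eta 3 oo - fps_X) = fps_to_fls (Eta 6) ^ 3 / (fps_to_fls (Eta 3) * fps_to_fls (Eta 12))"
  using arg_cong[OF Eta_compose_uminus_odd[of 1], of fps_to_fls]
    arg_cong[OF Eta_compose_uminus_odd[of 3], of fps_to_fls]
  by (simp_all add: to_fls Eta_nonzero field_simps del: One_nat_def)

lemma xx_uminus: "xx oo - fps_X = - xx"
  by (simp add: xx_def compose_uminus)

lemma qB_uminus: "qB oo - fps_X = qG"
  by (rule fps_to_fls_eq_imp_fps_eq)
     (simp add: qB_def compose_uminus to_fls Eta_uminus_fls fls_q Eta_nonzero field_simps
       power_numeral_reduce del: One_nat_def)

lemma qA_uminus: "qA oo - fps_X = qD"
  by (rule fps_to_fls_eq_imp_fps_eq)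
     (simp add: qA_def compose_uminus to_fls Eta_uminus_fls fls_q Eta_nonzero field_simps
       power_numeral_reduce del: One_nat_def)

lemma qD_minus_qG: "qD - qG = - 4 * xx"
proof -
  have "(qA - qB) oo - fps_X = (4 * xx) oo - fps_X"
    by (simp only: qA_minus_qB)
  moreover have "(4 * xx) oo - fps_X = - 4 * xx"
    by (simp add: fps_compose_mult_distrib xx_uminus)
  ultimately show ?thesis by (simp add: fps_compose_sub_distrib qB_uminus qA_uminus)
qed

section \<open>Rigidity under the substitution of q^2 for q\<close>

lemma qG_minus_qB: "qG - qB = 2 * xx"
proof -
  define W where "W = (\<lambda>f :: rat fps. f oo fps_X ^ 2)"
  define h where "h = qG - qB - 2 * xx"
  define I where "I = inverse qA"
  have A: "qA = qB + 4 * xx" and D: "qD = qG - 4 * xx"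
    using qA_minus_qB qD_minus_qG by (auto simp: algebra_simps)
  have W: "W (f + g) = W f + W g" "W (f - g) = W f - W g" "W (f * g) = W f * W g"
    "W (- f) = - W f" "W (numeral n) = numeral n" for f g n
    by (simp_all add: W_def fps_compose_add_distrib fps_compose_sub_distrib
        fps_compose_mult_distrib fps_compose_uminus)
  have W_lin: "W (4 * (- 2 * f - 2 * g)) = 4 * (- 2 * W f - 2 * W g)" for f g
    by (simp add: W)
  \<comment> \<open>The difference \<open>qA * qD - qB * qG\<close> is evaluated twice, by the
    linear relations and by the substitution identities. The terms in \<open>xx ^ 2\<close> cancel,
    leaving a homogeneous equation for the defect \<open>h\<close>.\<close>
  have "4 * (xx * (h - 2 * xx)) = qA * qD - qB * qG"
    by (simp add: A D h_def algebra_simps)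
  also have "\<dots> = W (qD ^ 2 * I - qG ^ 2 * I)"
    unfolding W(2) qA_qD qB_qG by (simp add: W_def I_def)
  also have "qD ^ 2 * I - qG ^ 2 * I = 4 * (- 2 * (xx * h * I) - 2 * (xx * qB * I))"
    by (simp add: D h_def algebra_simps power2_eq_square)
  also have "W \<dots> = 4 * (- 2 * W (xx * h * I) - 2 * xx ^ 2)"
    unfolding W_lin xx_power2 I_def[symmetric] by (simp add: W_def)
  finally have "4 * (xx * (h - 2 * xx)) = 4 * (- 2 * W (xx * h * I) - 2 * xx ^ 2)" .
  hence "xx * (h - 2 * xx) = - 2 * W (xx * h * I) - 2 * xx ^ 2"
    by (subst (asm) mult_cancel_left) auto
  moreover have "xx * (h - 2 * xx) = xx * h - 2 * xx ^ 2"
    by (simp add: algebra_simps power2_eq_square)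
  ultimately have H: "xx * h = - 2 * W (xx * h * I)"
    by (metis diff_add_cancel)
  txt \<open>The substitution \<open>q \<mapsto> q\<^sup>2\<close> doubles the order of vanishing, so \<open>H\<close> forces \<open>xx * h = 0\<close>.\<close>
  have "xx * h = 0"
  proof (rule ccontr)
    assume nz: "xx * h \<noteq> 0"
    have I0: "subdegree I = 0" "I \<noteq> 0"
      unfolding I_def by (auto simp: q_nth_0 intro: subdegree_eq_0)
    have "xx * h = - (2 * W (xx * h * I))" using H by (simp only: mult_minus_left)
    hence "subdegree (xx * h) = subdegree (2 * W (xx * h * I))"
      by (metis subdegree_uminus)
    also have "\<dots> = subdegree (2 :: rat fps) + subdegree (W (xx * h * I))"
      using nz H by (intro subdegree_mult) auto
    also have "subdegree (2 :: rat fps) = 0" by (rule subdegree_eq_0) simp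
    also have "0 + subdegree (W (xx * h * I)) = subdegree (W (xx * h * I))" by simp
    also have "\<dots> = 2 * subdegree (xx * h)"
      using nz I0 by (simp add: W_def)
    finally have "subdegree (xx * h) = 0" by simp
    hence "(xx * h) $ 0 \<noteq> 0" using nz by (metis nth_subdegree_nonzero)
    thus False by (simp add: q_nth_0)
  qed
  thus ?thesis using xx_nonzero by (simp add: h_def)
qed

text \<open>For g = c - 1 the equation reads g(q^2) = g (g + 2). The left side doubles the order of
  vanishing of g, the right side keeps it because g + 2 is a unit.\<close>

lemma fps_eq_1_if_square_eq_compose:
  fixes c :: "'a::field_char_0 fps"
  assumes "c ^ 2 = c oo fps_X ^ 2" "c $ 0 = 1"
  shows "c = 1"
proof (rule ccontr)
  assume "c \<noteq> 1"
  define g where "g = c - 1"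
  have g: "g \<noteq> 0" "g $ 0 = 0" using \<open>c \<noteq> 1\<close> assms by (auto simp: g_def)
  have g2: "(g + 2) $ 0 \<noteq> 0" using g by simp
  hence nz: "g + 2 \<noteq> 0" by (metis fps_zero_nth)
  have "g oo fps_X ^ 2 = g * (g + 2)"
    using assms(1) by (simp add: g_def fps_compose_sub_distrib power2_eq_square algebra_simps)
  moreover have "subdegree (g oo fps_X ^ 2) = subdegree g * 2" by simp
  ultimately have "subdegree g * 2 = subdegree g + subdegree (g + 2)"
    using g nz by simp
  moreover have "subdegree (g + 2) = 0" using g2 by (rule subdegree_eq_0)
  ultimately have "subdegree g = 0" by simp
  thus False using g nth_subdegree_nonzero[of g] by simp
qed

text \<open>For \<open>c = qB + xx\<close> the linear relations make \<open>qA\<close> a factor of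
  the substituted expression; it cancels against its inverse and leaves c^2 = c(q^2).\<close>

lemma qB_eq: "qB = 1 - xx"
proof -
  define W where "W = (\<lambda>f :: rat fps. f oo fps_X ^ 2)"
  define c where "c = qB + xx"
  define I where "I = inverse qA"
  have AI: "qA * I = 1" unfolding I_def by (rule inverse_mult_eq_1') (simp add: q_nth_0)
  have B: "qB = c - xx" and G: "qG = c + xx" and A: "qA = c + 3 * xx"
    using qG_minus_qB qA_minus_qB by (auto simp: c_def algebra_simps)
  have "c ^ 2 = qB * qG + xx ^ 2" by (simp add: B G algebra_simps power2_eq_square)
  also have "\<dots> = W (qG ^ 2 * I + xx * qB * I)"
    unfolding qB_qG xx_power2 by (simp add: W_def I_def fps_compose_add_distrib)
  also have "qG ^ 2 * I + xx * qB * I = c * (qA * I)"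
    by (simp add: B G A algebra_simps power2_eq_square)
  finally have "c ^ 2 = c oo fps_X ^ 2" by (simp add: AI W_def)
  moreover have "c $ 0 = 1" by (simp add: c_def q_nth_0)
  ultimately have "c = 1" by (rule fps_eq_1_if_square_eq_compose)
  thus ?thesis by (simp add: c_def algebra_simps)
qed

lemma qG_eq: "qG = 1 + xx"
  using qG_minus_qB by (simp add: qB_eq algebra_simps)

lemma qA_eq: "qA = 1 + 3 * xx"
  using qA_minus_qB by (simp add: qB_eq algebra_simps)

section \<open>The polynomials \<open>\<zeta>\<^bsub>i,j\<^esub>\<close>\<close>

abbreviation ipoly :: "int poly \<Rightarrow> 'a::comm_ring_1 \<Rightarrow> 'a" where
  "ipoly p \<equiv> poly (map_poly of_int p)"

lemma ipoly_pCons: "ipoly (pCons c p) a = of_int c + a * ipoly p a"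
  by (simp add: map_poly_pCons)

lemma ipoly_add: "ipoly (p + q) a = ipoly p a + ipoly q a"
  by (induction p q rule: poly_induct2) (simp_all add: ipoly_pCons algebra_simps)

lemma ipoly_smult: "ipoly (smult c p) a = of_int c * ipoly p a"
  by (induction p) (simp_all add: ipoly_pCons algebra_simps)

lemma ipoly_mult: "ipoly (p * q) a = ipoly p a * ipoly q a"
  by (induction p) (simp_all add: ipoly_pCons ipoly_add ipoly_smult algebra_simps)

lemma ipoly_diff: "ipoly (p - q) a = ipoly p a - ipoly q a"
  using ipoly_add[of "p - q" q a] by simp

lemma ipoly_monom: "ipoly (monom 1 n) a = a ^ n"
  by (simp add: map_poly_monom poly_monom)

lemmas ipoly_simps = ipoly_add ipoly_smult ipoly_mult ipoly_diff ipoly_monom ipoly_pCons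

lemma ipoly_compose:
  fixes a :: "'a::idom fps"
  assumes "w $ 0 = 0"
  shows "ipoly p a oo w = ipoly p (a oo w)"
proof (induction p)
  case (pCons c p)
  have "(of_int c :: 'a fps) oo w = of_int c"
    by (metis fps_const_compose fps_of_int)
  thus ?case using pCons
    by (simp add: ipoly_pCons fps_compose_add_distrib fps_compose_mult_distrib assms)
qed simp

text \<open>Gives uniqueness of the polynomial in \<open>Zpoly\<close>. After splitting off all
  factors X - r, where r is the constant term of \<open>a\<close>, the cofactor takes a value with
  nonzero constant term at \<open>a\<close>, while \<open>a\<close> - r is nonzero.\<close>

lemma fps_ipoly_eq_0D:
  fixes a :: "'a::field_char_0 fps"
  assumes a: "a \<noteq> fps_const (a $ 0)" and p: "ipoly p a = 0"
  shows "p = 0"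
proof (rule ccontr)
  assume "p \<noteq> 0"
  define r where "r = a $ 0"
  define q where "q = (map_poly of_int p :: 'a poly)"
  have nth0: "poly (map_poly fps_const s) a $ 0 = poly s r" for s :: "'a poly"
    by (induction s) (auto simp: map_poly_pCons r_def)
  have mult: "poly (map_poly fps_const (s * t)) a =
      poly (map_poly fps_const s) a * poly (map_poly fps_const t) a" for s t :: "'a poly"
  proof -
    have add: "poly (map_poly fps_const (s + t)) a =
      poly (map_poly fps_const s) a + poly (map_poly fps_const t) a" for s t :: "'a poly"
      by (induction s t rule: poly_induct2) (simp_all add: map_poly_pCons algebra_simps flip: fps_const_add)
    have smult: "poly (map_poly fps_const (smult c t)) a =
      fps_const c * poly (map_poly fps_const t) a" for c and t :: "'a poly"
      by (induction t) (simp_all add: map_poly_pCons algebra_simps flip: fps_const_mult)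
    show ?thesis
      by (induction s) (simp_all add: map_poly_pCons add smult algebra_simps)
  qed
  have power: "poly (map_poly fps_const (s ^ n)) a = poly (map_poly fps_const s) a ^ n"
    for s :: "'a poly" and n
    by (induction n) (simp_all add: mult)
  have "q \<noteq> 0" using \<open>p \<noteq> 0\<close> unfolding q_def
    by (metis coeff_0 coeff_map_poly leading_coeff_0_iff of_int_0 of_int_eq_0_iff)
  then obtain s where s: "q = [:- r, 1:] ^ order r q * s" "\<not> [:- r, 1:] dvd s"
    using order_decomp by blast
  have "map_poly fps_const q = map_poly of_int p"
    unfolding q_def by (rule poly_eqI) (simp add: coeff_map_poly fps_of_int)
  hence "poly (map_poly fps_const q) a = 0" using p by simp
  hence "poly (map_poly fps_const [:- r, 1:]) a ^ order r q * poly (map_poly fps_const s) a = 0"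
    by (subst (asm) s(1)) (simp only: mult power)
  hence "a - fps_const r = 0 \<or> poly (map_poly fps_const s) a = 0"
    by (auto simp: map_poly_pCons simp flip: fps_const_neg)
  moreover have "poly (map_poly fps_const s) a \<noteq> 0"
    using nth0[of s] s(2) by (metis fps_zero_nth poly_eq_0_iff_dvd)
  ultimately show False using a by (auto simp: r_def)
qed

section \<open>The conjugate pair \<open>uu\<close>, \<open>vv\<close>\<close>

definition uu :: "rat fps" where "uu = xi_sq * (1 + xx)"
definition vv :: "rat fps" where "vv = xi_sq * (1 - xx)"

lemma xi_sq_xx: "xi_sq * ((1 - xx) * (1 + xx)) = 1"
  using xi_sq_qB_qG by (simp only: qB_eq qG_eq)

text \<open>Hence symmetric integer polynomials in \<open>uu\<close> and \<open>vv\<close> are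
  integer polynomials in \<open>xi_sq\<close>.\<close>

lemma uu_vv: "uu + vv = 2 * xi_sq" "uu * vv = xi_sq"
proof -
  show "uu + vv = 2 * xi_sq" by (simp add: uu_def vv_def algebra_simps)
  have "uu * vv = xi_sq * (xi_sq * ((1 - xx) * (1 + xx)))"
    by (simp only: uu_def vv_def mult_ac)
  thus "uu * vv = xi_sq" by (simp add: xi_sq_xx)
qed

lemma kappa_uu: "kappa = uu ^ 5"
  by (simp add: kappa_eq qG_eq uu_def)

lemma xi_vv: "xi = 3 * vv - 2 * vv ^ 2"
proof -
  \<comment> \<open>The inserted factor is 1; its square supplies the \<open>qG ^ 2\<close> needed
    for \<open>xi_qG\<close> and leaves \<open>vv ^ 2\<close>.\<close>
  have "xi = xi * (xi_sq * ((1 - xx) * (1 + xx))) ^ 2"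
    by (simp add: xi_sq_xx)
  also have "\<dots> = (xi * qG ^ 2) * vv ^ 2"
    by (simp only: vv_def qG_eq power_mult_distrib mult_ac)
  also have "\<dots> = (1 + 3 * xx) * vv ^ 2"
    by (simp only: xi_qG qA_eq)
  also have "\<dots> = 3 * vv * (xi_sq * ((1 - xx) * (1 + xx))) - 2 * vv ^ 2"
    by (simp add: vv_def algebra_simps power2_eq_square)
  finally show ?thesis by (simp add: xi_sq_xx)
qed

lemma xi_sq_uminus: "xi_sq oo - fps_X = xi_sq"
  by (simp add: xi_sq_eq compose_uminus)

lemma uu_uminus: "uu oo - fps_X = vv" and vv_uminus: "vv oo - fps_X = uu"
  by (simp_all add: uu_def vv_def fps_compose_mult_distrib xi_sq_uminus xx_uminus
      fps_compose_add_distrib fps_compose_sub_distrib)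

text \<open>f(q) + f(-q) is twice the even part of f, and that part is \<open>Uop f\<close> at
  q^2.\<close>

lemma Uop_eqI:
  assumes "f + (f oo - fps_X) = 2 * (g oo fps_X ^ 2)"
  shows "Uop f = g"
proof (rule fps_ext)
  fix n
  have 1: "(f oo - fps_X) $ (2 * n) = f $ (2 * n)"
  proof -
    have "- fps_X = fps_const (- 1) * (fps_X :: rat fps)" by (simp flip: fps_const_neg)
    thus ?thesis by (simp only: fps_compose_linear) simp
  qed
  have "(g oo fps_X ^ 2) $ (2 * n) = (\<Sum>i=0..2*n. if i = n then g $ i else 0)"
    unfolding fps_compose_nth power_mult[symmetric]
    by (intro sum.cong) (auto simp: fps_X_power_nth)
  hence 2: "(g oo fps_X ^ 2) $ (2 * n) = g $ n" by simp
  have double: "(2 * h) $ k = h $ k + h $ k" for h :: "rat fps" and k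
    by (simp only: mult_2 fps_add_nth)
  have "(f + (f oo - fps_X)) $ (2 * n) = (2 * (g oo fps_X ^ 2)) $ (2 * n)"
    by (simp only: assms)
  hence "2 * f $ (2 * n) = 2 * g $ n"
    unfolding double fps_add_nth 1 2 by simp
  thus "Uop f $ n = g $ n" by (simp add: Uop_def)
qed

text \<open>\<open>zsum (5 * i) j\<close> is \<open>2 \<zeta>\<^bsub>i,j\<^esub>(q\<^sup>2)\<close>.\<close>

definition zsum :: "nat \<Rightarrow> nat \<Rightarrow> rat fps" where
  "zsum n j = uu ^ n * (3 * vv - 2 * vv ^ 2) ^ j + vv ^ n * (3 * uu - 2 * uu ^ 2) ^ j"

lemma xi_not_const: "xi \<noteq> fps_const (xi $ 0)"
proof
  assume "xi = fps_const (xi $ 0)"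
  hence "xi = 1" by (simp add: xi_nth_0)
  hence "xi_sq = 1" by (simp add: xi_sq_def)
  hence "xx * xx = 0" using xi_sq_xx by (simp add: algebra_simps)
  thus False using xx_nonzero by simp
qed

text \<open>Since q -> -q exchanges \<open>uu\<close> and \<open>vv\<close>,
  \<open>zsum (5 * i) j\<close> is \<open>kappa ^ i * xi ^ j\<close> plus its image.\<close>

lemma Zpoly_eqI:
  assumes "zsum (5 * i) j = 2 * ipoly p xi_sq"
  shows "Zpoly i j = p"
proof -
  have "(kappa ^ i * xi ^ j) oo - fps_X = vv ^ (5 * i) * (3 * uu - 2 * uu ^ 2) ^ j"
    by (simp add: kappa_uu xi_vv fps_compose_mult_distrib fps_compose_power[symmetric]
        fps_compose_sub_distrib uu_uminus vv_uminus power_mult)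
  moreover have "kappa ^ i * xi ^ j = uu ^ (5 * i) * (3 * vv - 2 * vv ^ 2) ^ j"
    by (simp add: kappa_uu xi_vv power_mult)
  ultimately have "kappa ^ i * xi ^ j + ((kappa ^ i * xi ^ j) oo - fps_X) = 2 * ipoly p xi_sq"
    using assms by (simp add: zsum_def)
  hence "zeta i j = ipoly p xi"
    unfolding zeta_def by (intro Uop_eqI) (simp add: ipoly_compose xi_sq_def)
  hence *: "zeta i j = poly_at_xi p" by (simp add: poly_at_xi_def)
  show ?thesis unfolding Zpoly_def
  proof (rule the_equality)
    fix q assume "zeta i j = poly_at_xi q"
    hence "ipoly (q - p) xi = 0"
      using * by (simp add: poly_at_xi_def ipoly_diff)
    thus "q = p" using fps_ipoly_eq_0D[OF xi_not_const, of "q - p"] by simp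
  qed (fact *)
qed

text \<open>The bases of the two \<open>j\<close>-th powers have sum and product symmetric in
  \<open>uu\<close> and \<open>vv\<close>.\<close>

lemma zsum_rec:
  "zsum n (j + 2) = (10 * xi_sq - 8 * xi_sq ^ 2) * zsum n (j + 1) - (9 * xi_sq - 8 * xi_sq ^ 2) * zsum n j"
proof -
  define s where "s = 3 * uu - 2 * uu ^ 2"
  define t where "t = 3 * vv - 2 * vv ^ 2"
  have "s + t = 3 * (uu + vv) - 2 * ((uu + vv) ^ 2 - 2 * (uu * vv))"
    by (simp add: s_def t_def algebra_simps power2_eq_square)
  hence st: "s + t = 10 * xi_sq - 8 * xi_sq ^ 2"
    by (simp add: uu_vv power2_eq_square algebra_simps)
  have "s * t = uu * vv * (9 - 6 * (uu + vv) + 4 * (uu * vv))"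
    by (simp add: s_def t_def algebra_simps power2_eq_square)
  hence st': "s * t = 9 * xi_sq - 8 * xi_sq ^ 2"
    unfolding uu_vv by (simp add: power2_eq_square algebra_simps)
  have "zsum n (j + 2) = (s + t) * zsum n (j + 1) - s * t * zsum n j"
    unfolding zsum_def s_def[symmetric] t_def[symmetric] by (simp add: algebra_simps)
  thus ?thesis by (simp only: st st')
qed

text \<open>With the Chebyshev polynomials \<open>T\<^bsub>n\<^esub>\<close> and \<open>a = z\<^sup>2\<close>: \<open>even_cheb n\<close> is \<open>T\<^bsub>2n\<^esub>(z)\<close> and
  \<open>odd_cheb n\<close> is \<open>T\<^bsub>2n+1\<^esub>(z) / z\<close>, as polynomials in \<open>a\<close>.\<close>

fun even_cheb :: "nat \<Rightarrow> int poly" where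
  "even_cheb 0 = 1"
| "even_cheb (Suc 0) = [:-1, 2:]"
| "even_cheb (Suc (Suc n)) = [:-2, 4:] * even_cheb (Suc n) - even_cheb n"

fun odd_cheb :: "nat \<Rightarrow> int poly" where
  "odd_cheb 0 = 1"
| "odd_cheb (Suc 0) = [:-3, 4:]"
| "odd_cheb (Suc (Suc n)) = [:-2, 4:] * odd_cheb (Suc n) - odd_cheb n"

section \<open>Power sums of \<open>uu\<close> and \<open>vv\<close>\<close>

lemma power_sum_rec:
  "uu ^ (n + 4) + vv ^ (n + 4) =
     (4 * xi_sq ^ 2 - 2 * xi_sq) * (uu ^ (n + 2) + vv ^ (n + 2)) - xi_sq ^ 2 * (uu ^ n + vv ^ n)"
proof -
  have "uu ^ (n + 4) + vv ^ (n + 4) =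
     ((uu + vv) ^ 2 - 2 * (uu * vv)) * (uu ^ (n + 2) + vv ^ (n + 2)) -
     (uu * vv) ^ 2 * (uu ^ n + vv ^ n)"
    by (simp add: power2_eq_square power_add eval_nat_numeral algebra_simps)
  thus ?thesis by (simp add: uu_vv power_mult_distrib)
qed

text \<open>Formally \<open>uu\<close> and \<open>vv\<close> are z exp(it) and z exp(-it) with z^2 =
  \<open>xi_sq\<close> and cos t = z, so the n-th power sum is 2 z^n T_n(z).\<close>

lemma power_sum_even: "uu ^ (2 * m) + vv ^ (2 * m) = 2 * (xi_sq ^ m * ipoly (even_cheb m) xi_sq)"
proof (induction m rule: even_cheb.induct)
  case 2
  have "uu ^ 2 + vv ^ 2 = (uu + vv) ^ 2 - 2 * (uu * vv)"
    by (simp add: power2_eq_square algebra_simps)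
  thus ?case by (simp add: uu_vv ipoly_simps power2_eq_square algebra_simps)
next
  case (3 m)
  have idx: "2 * Suc (Suc m) = 2 * m + 4" "2 * Suc m = 2 * m + 2" by simp_all
  have "uu ^ (2 * Suc (Suc m)) + vv ^ (2 * Suc (Suc m)) =
      (4 * xi_sq ^ 2 - 2 * xi_sq) * (uu ^ (2 * Suc m) + vv ^ (2 * Suc m)) -
         xi_sq ^ 2 * (uu ^ (2 * m) + vv ^ (2 * m))"
    using power_sum_rec[of "2 * m"] by (simp only: idx)
  thus ?case unfolding 3
    by (simp add: ipoly_simps power2_eq_square algebra_simps)
qed simp

lemma power_sum_odd:
  "uu ^ (2 * m + 1) + vv ^ (2 * m + 1) = 2 * (xi_sq ^ (m + 1) * ipoly (odd_cheb m) xi_sq)"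
proof (induction m rule: odd_cheb.induct)
  case 1
  show ?case by (simp add: uu_vv)
next
  case 2
  have "uu ^ 3 + vv ^ 3 = (uu + vv) ^ 3 - 3 * (uu * vv) * (uu + vv)"
    by (simp add: power3_eq_cube algebra_simps)
  hence "uu ^ 3 + vv ^ 3 = 8 * xi_sq ^ 3 - 6 * xi_sq ^ 2"
    unfolding uu_vv by (simp add: power2_eq_square power3_eq_cube algebra_simps)
  thus ?case by (simp add: ipoly_simps power2_eq_square power3_eq_cube algebra_simps)
next
  case (3 m)
  have idx: "2 * Suc (Suc m) + 1 = 2 * m + 1 + 4" "2 * Suc m + 1 = 2 * m + 1 + 2" by simp_all
  have "uu ^ (2 * Suc (Suc m) + 1) + vv ^ (2 * Suc (Suc m) + 1) =
      (4 * xi_sq ^ 2 - 2 * xi_sq) * (uu ^ (2 * Suc m + 1) + vv ^ (2 * Suc m + 1)) -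
         xi_sq ^ 2 * (uu ^ (2 * m + 1) + vv ^ (2 * m + 1))"
    using power_sum_rec[of "2 * m + 1"] by (simp only: idx)
  thus ?case unfolding 3
    by (simp add: ipoly_simps power2_eq_square algebra_simps)
qed

lemma coeff_linear_mult:
  "coeff ([:a, b:] * p) 0 = a * coeff p 0"
  "coeff ([:a, b:] * p) (Suc n) = a * coeff p (Suc n) + b * coeff p n"
  by simp_all

section \<open>2-adic valuations of the coefficients\<close>

text \<open>In the recurrence a rise in degree comes with a factor 4. Modulo 4 the linear
  coefficient is merely negated when the index grows by two, hence the parity condition.\<close>

lemma even_cheb_coeff:
  "odd (coeff (even_cheb m) 0) \<and> (even m \<longrightarrow> 4 dvd coeff (even_cheb m) 1) \<and>
   (\<forall>n. 2 ^ (2 * n + 1) dvd coeff (even_cheb m) (Suc n))"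
proof (induction m rule: even_cheb.induct)
  case 1
  show ?case by (simp add: one_pCons)
next
  case 2
  show ?case by (auto simp: coeff_pCons split: nat.split)
next
  case (3 m)
  let ?a = "even_cheb m" and ?b = "even_cheb (Suc m)"
  have a: "odd (coeff ?a 0)" "even m \<Longrightarrow> 4 dvd coeff ?a 1"
    "\<And>n. 2 ^ (2 * n + 1) dvd coeff ?a (Suc n)" using 3 by auto
  have b: "odd (coeff ?b 0)" "\<And>n. 2 ^ (2 * n + 1) dvd coeff ?b (Suc n)" using 3 by auto
  have rec: "coeff (even_cheb (Suc (Suc m))) 0 = - 2 * coeff ?b 0 - coeff ?a 0"
    "coeff (even_cheb (Suc (Suc m))) (Suc n) =
       - 2 * coeff ?b (Suc n) + 4 * coeff ?b n - coeff ?a (Suc n)" for n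
    by simp_all
  have "odd (coeff (even_cheb (Suc (Suc m))) 0)"
    unfolding rec using a(1) by simp
  moreover have "4 dvd coeff (even_cheb (Suc (Suc m))) 1" if "even (Suc (Suc m))"
  proof -
    have "4 dvd coeff ?a (Suc 0)" using a(2) that by simp
    moreover have "2 dvd coeff ?b (Suc 0)" using b(2)[of 0] by simp
    ultimately show ?thesis unfolding One_nat_def rec by presburger
  qed
  moreover have "2 ^ (2 * n + 1) dvd coeff (even_cheb (Suc (Suc m))) (Suc n)" for n
  proof -
    have "2 ^ (2 * n + 1) dvd 4 * coeff ?b n"
    proof (cases n)
      case (Suc k)
      have "4 * 2 ^ (2 * k + 1) dvd 4 * coeff ?b (Suc k)" by (intro mult_dvd_mono b) simp
      thus ?thesis by (simp add: Suc)
    qed simp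
    thus ?thesis unfolding rec using a(3)[of n] b(2)[of n]
      by (intro dvd_diff dvd_add) (auto intro: dvd_mult)
  qed
  ultimately show ?case by blast
qed

lemma odd_cheb_coeff:
  "odd (coeff (odd_cheb m) 0) \<and> (\<forall>n. 4 ^ n dvd coeff (odd_cheb m) n)"
proof (induction m rule: odd_cheb.induct)
  case 1
  show ?case by (auto simp: one_pCons coeff_pCons split: nat.split)
next
  case 2
  show ?case by (auto simp: coeff_pCons split: nat.split)
next
  case (3 m)
  let ?a = "odd_cheb m" and ?b = "odd_cheb (Suc m)"
  have rec: "coeff (odd_cheb (Suc (Suc m))) 0 = - 2 * coeff ?b 0 - coeff ?a 0"
    "coeff (odd_cheb (Suc (Suc m))) (Suc n) =
       - 2 * coeff ?b (Suc n) + 4 * coeff ?b n - coeff ?a (Suc n)" for n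
    by simp_all
  have "odd (coeff (odd_cheb (Suc (Suc m))) 0)"
    unfolding rec using 3 by simp
  moreover have "4 ^ n dvd coeff (odd_cheb (Suc (Suc m))) n" for n
  proof (cases n)
    case (Suc k)
    have "4 ^ Suc k dvd 4 * coeff ?b k" using 3 by simp
    thus ?thesis unfolding Suc rec using 3
      by (intro dvd_diff dvd_add) (auto intro: dvd_mult simp del: power_Suc)
  qed simp
  ultimately show ?case by blast
qed

text \<open>The claimed pattern once the power of \<open>xi\<close> is split off; \<open>c\<close>
  will be 2 for \<open>j\<close> congruent to 2 modulo 4 and 0 otherwise.\<close>

definition two_adic_shape :: "int \<Rightarrow> int poly \<Rightarrow> bool" where
  "two_adic_shape c p \<longleftrightarrow> odd (coeff p 0) \<and> 4 dvd (coeff p 1 - c) \<and>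
     (\<forall>n\<ge>2. 2 ^ (n + 1) dvd coeff p n)"

lemma two_adic_shapeD:
  assumes "two_adic_shape c p"
  shows "odd (coeff p 0)" "4 dvd coeff p 1 - c" "n \<ge> 2 \<Longrightarrow> 2 ^ (n + 1) dvd coeff p n"
  using assms by (simp_all add: two_adic_shape_def)

lemma two_adic_shape_even_coeff_1:
  assumes "two_adic_shape c p" "even c"
  shows "even (coeff p 1)"
  using two_adic_shapeD(2)[OF assms(1)] assms(2) by presburger

text \<open>For odd \<open>m\<close> the index \<open>m + 1\<close> is even, so the linear
  coefficient of \<open>even_cheb (m + 1)\<close> is divisible by 4.\<close>

lemma zsum_start:
  assumes "odd m"
  shows "\<exists>e f. two_adic_shape 0 e \<and> two_adic_shape 0 f \<and>
           zsum (2 * (m + 1)) 0 = 2 * (xi_sq ^ (m + 1) * ipoly e xi_sq) \<and>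
           zsum (2 * (m + 1)) 1 = 2 * (xi_sq ^ (m + 2) * ipoly f xi_sq)"
proof (intro exI conjI)
  let ?e = "even_cheb (m + 1)" and ?f = "smult 3 (odd_cheb m) - smult 2 (even_cheb m)"
  have even_dvd: "2 ^ (2 * n) dvd 2 * coeff (even_cheb l) n" if n1: "n \<ge> 1" for l n
  proof -
    obtain k where n: "n = Suc k" using n1 by (cases n) auto
    have "2 * 2 ^ (2 * k + 1) dvd 2 * coeff (even_cheb l) (Suc k)"
      using even_cheb_coeff[of l] by (intro mult_dvd_mono) auto
    thus ?thesis by (simp add: n)
  qed
  have odd_dvd: "2 ^ (2 * n) dvd coeff (odd_cheb l) n" for l n
    using odd_cheb_coeff[of l] by (simp add: power_mult)
  show "two_adic_shape 0 ?e"
    unfolding two_adic_shape_def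
  proof (intro conjI allI impI)
    fix n :: nat assume "n \<ge> 2"
    then obtain k where n: "n = Suc k" "k \<ge> 1" by (cases n) auto
    have "2 ^ (n + 1) dvd (2 ^ (2 * k + 1) :: int)"
      using n by (intro le_imp_power_dvd) auto
    also have "\<dots> dvd coeff ?e (Suc k)" using even_cheb_coeff[of "m + 1"] by blast
    finally show "2 ^ (n + 1) dvd coeff ?e n" by (simp only: n)
  qed (use even_cheb_coeff[of "m + 1"] assms in auto)
  show "two_adic_shape 0 ?f"
    unfolding two_adic_shape_def
  proof (intro conjI allI impI)
    show "odd (coeff ?f 0)" using odd_cheb_coeff[of m] by simp
    show "4 dvd coeff ?f 1 - 0"
      using even_dvd[of 1 m] odd_dvd[of 1 m] by (auto intro!: dvd_diff dvd_mult)
    fix n :: nat assume "n \<ge> 2"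
    hence "2 ^ (n + 1) dvd (2 ^ (2 * n) :: int)"
      by (intro le_imp_power_dvd) auto
    also have "\<dots> dvd coeff ?f n"
      using even_dvd[of n m] odd_dvd[of n m] \<open>n \<ge> 2\<close> by (auto intro!: dvd_diff dvd_mult)
    finally show "2 ^ (n + 1) dvd coeff ?f n" .
  qed
  show "zsum (2 * (m + 1)) 0 = 2 * (xi_sq ^ (m + 1) * ipoly ?e xi_sq)"
    using power_sum_even[of "m + 1"] by (simp add: zsum_def)
  \<comment> \<open>Pairing powers of \<open>uu\<close> with \<open>vv\<close> and
    \<open>vv ^ 2\<close> releases one and two factors \<open>uu * vv\<close>.\<close>
  have "zsum (2 * (m + 1)) 1 = 3 * (uu * vv) * (uu ^ (2 * m + 1) + vv ^ (2 * m + 1)) -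
          2 * (uu * vv) ^ 2 * (uu ^ (2 * m) + vv ^ (2 * m))"
    by (simp add: zsum_def algebra_simps power2_eq_square)
  also have "\<dots> = 2 * (xi_sq ^ (m + 2) * ipoly ?f xi_sq)"
    unfolding power_sum_even power_sum_odd uu_vv
    by (simp add: ipoly_diff ipoly_smult algebra_simps power2_eq_square)
  finally show "zsum (2 * (m + 1)) 1 = 2 * (xi_sq ^ (m + 2) * ipoly ?f xi_sq)" .
qed

text \<open>Advances \<open>j\<close> by two while the exponent of \<open>xi_sq\<close> grows by
  one. The two parities of \<open>j\<close> have exponents \<open>l\<close> and
  \<open>l + 1\<close>, so \<open>e\<close> and \<open>f\<close> need different updates.\<close>

lemma zsum_step:
  assumes e: "two_adic_shape c e" and f: "two_adic_shape 0 f" and c: "even c"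
  assumes z0: "zsum n j = 2 * (xi_sq ^ l * ipoly e xi_sq)"
  assumes z1: "zsum n (j + 1) = 2 * (xi_sq ^ (l + 1) * ipoly f xi_sq)"
  shows "\<exists>e' f'. two_adic_shape (2 - c) e' \<and> two_adic_shape 0 f' \<and>
           zsum n (j + 2) = 2 * (xi_sq ^ (l + 1) * ipoly e' xi_sq) \<and>
           zsum n (j + 3) = 2 * (xi_sq ^ (l + 2) * ipoly f' xi_sq)"
proof (intro exI conjI)
  let ?e = "pCons 0 ([:10, -8:] * f) - [:9, -8:] * e"
  let ?f = "[:10, -8:] * ?e - [:9, -8:] * f"
  have ce: "coeff ?e 0 = - 9 * coeff e 0"
    "coeff ?e 1 = 10 * coeff f 0 - 9 * coeff e 1 + 8 * coeff e 0"
    "coeff ?e (Suc (Suc k)) = 10 * coeff f (Suc k) - 8 * coeff f k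
        - 9 * coeff e (Suc (Suc k)) + 8 * coeff e (Suc k)" for k
    by simp_all
  have cf: "coeff ?f 0 = 10 * coeff ?e 0 - 9 * coeff f 0"
    "coeff ?f (Suc k) = 10 * coeff ?e (Suc k) - 8 * coeff ?e k - 9 * coeff f (Suc k) + 8 * coeff f k" for k
    unfolding coeff_diff coeff_linear_mult by simp_all
  have shift8: "2 ^ (k + 3) dvd 8 * coeff p k"
    if p: "two_adic_shape b p" "even b" for b p k
  proof -
    have 1: "even (coeff p 1)" by (rule two_adic_shape_even_coeff_1) fact+
    have "2 ^ k dvd coeff p k"
    proof -
      consider "k = 0" | "k = 1" | "k \<ge> 2" by linarith
      thus ?thesis
      proof cases
        case 3
        hence "2 ^ (k + 1) dvd coeff p k" by (intro two_adic_shapeD(3)[OF p(1)])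
        thus ?thesis by (meson dvd_trans le_imp_power_dvd le_add1)
      qed (use 1 in auto)
    qed
    hence "8 * 2 ^ k dvd 8 * coeff p k" by (rule mult_dvd_mono[OF dvd_refl])
    thus ?thesis by (simp add: power_add mult.commute)
  qed
  \<comment> \<open>Shape constant 0 matters here: for \<open>k = 0\<close> the linear coefficient
    must be divisible by 4.\<close>
  have shift10: "2 ^ (k + 3) dvd 10 * coeff p (Suc k)" if p: "two_adic_shape 0 p" for p k
  proof -
    have "2 ^ (k + 2) dvd coeff p (Suc k)"
    proof (cases k)
      case 0
      thus ?thesis using two_adic_shapeD(2)[OF p] by simp
    next
      case (Suc i)
      have "2 ^ (Suc k + 1) dvd coeff p (Suc k)"
        by (rule two_adic_shapeD(3)[OF p]) (simp add: Suc)
      thus ?thesis by simp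
    qed
    hence "2 * 2 ^ (k + 2) dvd 10 * coeff p (Suc k)" by (intro mult_dvd_mono) auto
    thus ?thesis by (simp add: power_add mult.commute)
  qed
  show e': "two_adic_shape (2 - c) ?e"
    unfolding two_adic_shape_def
  proof (intro conjI allI impI)
    show "odd (coeff ?e 0)" unfolding ce using two_adic_shapeD(1)[OF e] by simp
    \<comment> \<open>Modulo 4, \<open>10 * coeff f 0\<close> is 2 since \<open>coeff f 0\<close> is
      odd, and \<open>- 9 * coeff e 1\<close> is \<open>- c\<close>. This alternation singles out
      \<open>j\<close> congruent to 2 modulo 4.\<close>
    show "4 dvd coeff ?e 1 - (2 - c)"
      unfolding ce using two_adic_shapeD(1,2)[OF e] two_adic_shapeD(1)[OF f] c by presburger
    fix n :: nat assume "n \<ge> 2"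
    then obtain k where n: "n = Suc (Suc k)" by (metis add_2_eq_Suc le_Suc_ex)
    have n3: "n + 1 = k + 3" by (simp add: n)
    have "2 ^ (n + 1) dvd 10 * coeff f (Suc k)"
      unfolding n3 by (rule shift10) fact
    moreover have "2 ^ (n + 1) dvd 8 * coeff f k"
      unfolding n3 by (rule shift8[OF f]) simp
    moreover have "2 ^ (n + 1) dvd 8 * coeff e (Suc k)"
      by (rule power_le_dvd[OF shift8[OF e c, of "Suc k"]]) (simp add: n)
    moreover have "2 ^ (n + 1) dvd 9 * coeff e (Suc (Suc k))"
      using two_adic_shapeD(3)[OF e \<open>n \<ge> 2\<close>] unfolding n by (rule dvd_mult)
    ultimately show "2 ^ (n + 1) dvd coeff ?e n"
      unfolding n ce by (intro dvd_add dvd_diff)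
  qed
  show "two_adic_shape 0 ?f"
    unfolding two_adic_shape_def
  proof (intro conjI allI impI)
    show "odd (coeff ?f 0)" unfolding cf using two_adic_shapeD(1)[OF f] by simp
    have "even (coeff ?e 1)" using two_adic_shape_even_coeff_1[OF e'] c by simp
    thus "4 dvd coeff ?f 1 - 0"
      using two_adic_shapeD(2)[OF f] unfolding One_nat_def cf by presburger
    fix n :: nat assume "n \<ge> 2"
    then obtain k where n: "n = Suc (Suc k)" by (metis add_2_eq_Suc le_Suc_ex)
    have "2 ^ (n + 1) dvd 10 * coeff ?e (Suc (Suc k))"
      using two_adic_shapeD(3)[OF e' \<open>n \<ge> 2\<close>] unfolding n by (rule dvd_mult)
    moreover have "2 ^ (n + 1) dvd 9 * coeff f (Suc (Suc k))"
      using two_adic_shapeD(3)[OF f \<open>n \<ge> 2\<close>] unfolding n by (rule dvd_mult)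
    moreover have "2 ^ (n + 1) dvd 8 * coeff ?e (Suc k)"
      by (rule power_le_dvd[OF shift8[OF e', of "Suc k"]]) (use c in \<open>simp_all add: n\<close>)
    moreover have "2 ^ (n + 1) dvd 8 * coeff f (Suc k)"
      by (rule power_le_dvd[OF shift8[OF f, of "Suc k"]]) (simp_all add: n)
    ultimately show "2 ^ (n + 1) dvd coeff ?f n"
      unfolding n cf by (intro dvd_add dvd_diff)
  qed
  have ie_eq: "ipoly ?e xi_sq =
      xi_sq * ((10 - 8 * xi_sq) * ipoly f xi_sq) - (9 - 8 * xi_sq) * ipoly e xi_sq"
    by (simp only: ipoly_pCons ipoly_diff ipoly_mult) (simp add: algebra_simps)
  have if_eq: "ipoly ?f xi_sq =
      (10 - 8 * xi_sq) * ipoly ?e xi_sq - (9 - 8 * xi_sq) * ipoly f xi_sq"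
    unfolding ipoly_diff[of _ "[:9, -8:] * f"] ipoly_mult
    by (simp only: ipoly_pCons) (simp add: algebra_simps)
  have z2: "zsum n (j + 2) = 2 * (xi_sq ^ (l + 1) * ipoly ?e xi_sq)"
    unfolding zsum_rec z0 z1 ie_eq by (simp add: algebra_simps power2_eq_square)
  thus "zsum n (j + 2) = 2 * (xi_sq ^ (l + 1) * ipoly ?e xi_sq)" .
  have "zsum n (j + 3) = (10 * xi_sq - 8 * xi_sq ^ 2) * zsum n (j + 2)
           - (9 * xi_sq - 8 * xi_sq ^ 2) * zsum n (j + 1)"
    using zsum_rec[of n "j + 1"] by (simp add: eval_nat_numeral)
  also have "\<dots> = 2 * (xi_sq ^ (l + 2) * ipoly ?f xi_sq)"
    unfolding z1 z2 if_eq by (simp add: algebra_simps power2_eq_square del: mult_pCons_left)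
  finally show "zsum n (j + 3) = 2 * (xi_sq ^ (l + 2) * ipoly ?f xi_sq)" .
qed

lemma zsum_shape:
  assumes "odd m"
  shows "\<exists>e f. two_adic_shape (if odd J then 2 else 0) e \<and> two_adic_shape 0 f \<and>
           zsum (2 * (m + 1)) (2 * J) = 2 * (xi_sq ^ (m + 1 + J) * ipoly e xi_sq) \<and>
           zsum (2 * (m + 1)) (2 * J + 1) = 2 * (xi_sq ^ (m + 1 + J + 1) * ipoly f xi_sq)"
proof (induction J)
  case 0
  thus ?case using zsum_start[OF assms] by simp
next
  case (Suc J)
  then obtain e f where ef: "two_adic_shape (if odd J then 2 else 0) e" "two_adic_shape 0 f"
    "zsum (2 * (m + 1)) (2 * J) = 2 * (xi_sq ^ (m + 1 + J) * ipoly e xi_sq)"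
    "zsum (2 * (m + 1)) (2 * J + 1) = 2 * (xi_sq ^ (m + 1 + J + 1) * ipoly f xi_sq)"
    by blast
  have "even (if odd J then 2 else 0 :: int)" by simp
  from zsum_step[OF ef(1,2) this ef(3,4)] obtain e' f' where
    ef': "two_adic_shape (2 - (if odd J then 2 else 0)) e'" "two_adic_shape 0 f'"
    "zsum (2 * (m + 1)) (2 * J + 2) = 2 * (xi_sq ^ (m + 1 + J + 1) * ipoly e' xi_sq)"
    "zsum (2 * (m + 1)) (2 * J + 3) = 2 * (xi_sq ^ (m + 1 + J + 2) * ipoly f' xi_sq)"
    by blast
  have idx: "2 * Suc J = 2 * J + 2" "2 * Suc J + 1 = 2 * J + 3"
    "m + 1 + Suc J = m + 1 + J + 1" "m + 1 + Suc J + 1 = m + 1 + J + 2" by simp_all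
  have "two_adic_shape (if odd (Suc J) then 2 else 0) e'"
    using ef'(1) by (cases "odd J") simp_all
  moreover have "zsum (2 * (m + 1)) (2 * Suc J) = 2 * (xi_sq ^ (m + 1 + Suc J) * ipoly e' xi_sq)"
    unfolding idx by (rule ef')
  moreover have "zsum (2 * (m + 1)) (2 * Suc J + 1) =
      2 * (xi_sq ^ (m + 1 + Suc J + 1) * ipoly f' xi_sq)"
    unfolding idx(2,4) by (rule ef')
  ultimately show ?case using ef'(2) by blast
qed

section \<open>From divisibility to valuations\<close>

lemma nu_eq_0: "odd n \<Longrightarrow> nu n = 0"
  using not_dvd_imp_multiplicity_0[of 2 n] by (cases "n = 0") (simp_all add: nu_def enat_0)

lemma nu_eq_1:
  assumes "4 dvd n - 2"
  shows "nu n = 1"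
proof -
  have "even n" "\<not> 4 dvd n" using assms by presburger+
  hence "multiplicity 2 n = 1" by (intro multiplicity_eqI) auto
  moreover have "n \<noteq> 0" using assms by auto
  ultimately show ?thesis by (simp add: nu_def one_enat_def)
qed

lemma nu_ge:
  assumes "2 ^ k dvd n"
  shows "nu n \<ge> enat k"
  using multiplicity_geI[of n 2 k] assms by (cases "n = 0") (simp_all add: nu_def)

text \<open>As \<open>i\<close> is even and \<open>5 * (i div 2) = m + 1\<close>, the exponents in
  \<open>zsum_shape\<close> are exactly \<open>d i j\<close>.\<close>

lemma two_adic_shape_Zpoly:
  assumes "odd m" "5 * i = 2 * (m + 1)"
  shows "\<exists>p. Zpoly i j = monom 1 (d i j) * p \<and> two_adic_shape (if j mod 4 = 2 then 2 else 0) p"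
proof -
  have "even i" using assms by presburger
  hence i: "5 * (i div 2) = m + 1" using assms by presburger
  define J where "J = j div 2"
  obtain e f where ef: "two_adic_shape (if odd J then 2 else 0) e" "two_adic_shape 0 f"
    "zsum (5 * i) (2 * J) = 2 * (xi_sq ^ (m + 1 + J) * ipoly e xi_sq)"
    "zsum (5 * i) (2 * J + 1) = 2 * (xi_sq ^ (m + 1 + J + 1) * ipoly f xi_sq)"
    using zsum_shape[OF assms(1), of J] unfolding assms(2) by blast
  show ?thesis
  proof (cases "even j")
    case True
    hence j: "j = 2 * J" by (simp add: J_def)
    have "odd J \<longleftrightarrow> j mod 4 = 2" unfolding j by presburger
    moreover have "Zpoly i j = monom 1 (d i j) * e"
      using ef(3) \<open>even i\<close> True
      by (intro Zpoly_eqI) (simp add: ipoly_mult ipoly_monom d_def i j)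
    ultimately show ?thesis using ef(1) by metis
  next
    case False
    hence j: "j = 2 * J + 1" by (simp add: J_def)
    have "j mod 4 \<noteq> 2" using False by presburger
    moreover have "Zpoly i j = monom 1 (d i j) * f"
      using ef(4) \<open>even i\<close> False
      by (intro Zpoly_eqI) (simp add: ipoly_mult ipoly_monom d_def i j)
    ultimately show ?thesis using ef(2) by metis
  qed
qed

theorem theorem4p4:
  fixes k j :: nat
  assumes "k \<ge> 2"
  shows "nu (Z (2^k) j (d (2^k) j)) = 0
       \<and> (j mod 4 = 2 \<longrightarrow> nu (Z (2^k) j (d (2^k) j + 1)) = 1)
       \<and> (j mod 4 \<noteq> 2 \<longrightarrow> nu (Z (2^k) j (d (2^k) j + 1)) \<ge> 2)
       \<and> (\<forall>M::nat. M \<ge> 2 \<longrightarrow> nu (Z (2^k) j (d (2^k) j + M)) \<ge> enat (M + 1))"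
proof -
  obtain l where k: "k = Suc (Suc l)" using assms by (metis add_2_eq_Suc le_Suc_ex)
  \<comment> \<open>So \<open>m + 1\<close> is 5 * 2^(k-1), which is even because
    \<open>k \<ge> 2\<close>.\<close>
  define m where "m = 5 * (2 * 2 ^ l) - (1 :: nat)"
  have m: "m + 1 = 2 * (5 * 2 ^ l)" by (simp add: m_def)
  hence "odd m" "5 * 2 ^ k = 2 * (m + 1)" unfolding k by (presburger, simp)
  then obtain p where p: "Zpoly (2 ^ k) j = monom 1 (d (2 ^ k) j) * p"
    "two_adic_shape (if j mod 4 = 2 then 2 else 0) p"
    using two_adic_shape_Zpoly by blast
  have Z: "Z (2 ^ k) j (d (2 ^ k) j + n) = coeff p n" for n
    by (simp add: Z_def p(1) coeff_monom_mult)
  have "nu (coeff p 0) = 0"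
    by (rule nu_eq_0) (rule two_adic_shapeD(1)[OF p(2)])
  moreover have "nu (coeff p 1) = 1" if "j mod 4 = 2"
    using two_adic_shapeD(2)[OF p(2)] that by (intro nu_eq_1) simp
  moreover have "nu (coeff p 1) \<ge> 2" if "j mod 4 \<noteq> 2"
    using two_adic_shapeD(2)[OF p(2)] that nu_ge[of 2 "coeff p 1"]
    by (simp add: numeral_eq_enat)
  moreover have "nu (coeff p n) \<ge> enat (n + 1)" if "n \<ge> 2" for n
    using two_adic_shapeD(3)[OF p(2) that] by (rule nu_ge)
  ultimately show ?thesis unfolding Z Z[of 0, simplified] by blast
qed

end
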